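(* Let $\Lambda$ be a row-finite $2$-graph with no sources. Then the groupoid $G_\Lambda$ (equivalently, the shift action $T\colon\mathbb N^2\curvearrowright\Lambda^\infty$) admits harmonious families of bisections; that is, for every $x\in\Lambda^\infty$ there is a harmonious family of bisections of $G_\Lambda$ based at $x$.
   Context: $\mathbb N$ contains $0$. A $k$-graph is a countable category $\Lambda$ with a functor $d\colon\Lambda\to\mathbb N^k$ such that whenever $d(\lambda)=m+n$ there are unique $\mu,\nu$ with $\lambda=\mu\nu$, $d(\mu)=m$, $d(\nu)=n$. $\Lambda^n=d^{-1}(n)$, $\Lambda^0$ is identified with the objects, $v\Lambda^n=\{\lambda\in\Lambda^n:r(\lambda)=v\}$. $\Lambda$ is row-finite with no sources if $0<|v\Lambda^n|<\infty$ for all $v\in\Lambda^0$, $n\in\mathbb N^k$. With $\Omega_k=\{(m,n)\in\mathbb N^k\times\mathbb N^k:m\le n\}$ the standard $k$-graph, $\Lambda^\infty$ is the set of degree-preserving functors $x\colon\Omega_k\to\Lambda$, with topology generated by the compact open cylinder sets $Z(\lambda)=\{x:x(0,d(\lambda))=\lambda\}$. The shift action $T\colon\mathbb N^k\curvearrowright\Lambda^\infty$, $T^p(x)(m,n)=x(m+p,n+p)$, is an action by local homeomorphisms of the second-countable locally compact Hausdorff space $X=\Lambda^\infty$, and $G_\Lambda=G_T$ is its Deaconu--Renault groupoid. Deaconu--Renault groupoid: $G_T=\{(x,p-q,y):x,y\in X,\ p,q\in\mathbb N^k,\ T^p(x)=T^q(y)\}$ with $r(x,m,y)=x$, $s(x,m,y)=y$,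 $(x,m,y)(y,n,w)=(x,m+n,w)$, $(x,m,y)^{-1}=(y,-m,x)$, units $(x,0,x)$ identified with $x\in X$, and topology with basis the sets $\{(x,p-q,y):x\in U,y\in V,T^p(x)=T^q(y)\}$, $U,V\subseteq X$ open, $p,q\in\mathbb N^k$. The canonical cocycle is $c(x,m,y)=m$; $[x]=\{r(\gamma):s(\gamma)=x\}$ is the orbit. An open bisection is an open subset on which $r$ and $s$ restrict to homeomorphisms onto open sets. Isotropy: for an étale groupoid $G$, $\mathcal I(G)=\{\gamma:r(\gamma)=s(\gamma)\}$ with fibres $\mathcal I(G)_x$, and $\mathcal I^\circ(G)$ is its interior in $G$; $G|_Y=\{\gamma:r(\gamma),s(\gamma)\in Y\}$ with the subspace topology. $\mathcal I^{\mathrm{ess}}_x=\mathcal I^\circ(G|_{\overline{[x]}})\cap\mathcal I(G)_x$, $\mathcal I^{\mathrm{ess}}=\bigsqcup_x\mathcal I^{\mathrm{ess}}_x$. $\mathcal J=\overline{\mathcal I^{\mathrm{ess}}}$ denotes the smallest closed subgroupoid containing $\mathcal I^{\mathrm{ess}}$, and $\mathcal J_x=\mathcal J\cap\mathcal I(G)_x$. A harmonious family of bisections based at $x\in X$ is a collection $\mathcal B=(B_\alpha)_{\alpha\in\mathcal J_x}$ of open bisections of $G_T$ such that: (i) $B_x\subseteq X$; (ii) $\alpha\in B_\alpha\subseteq c^{-1}(c(\alpha))$ for all $\alpha\in\mathcal J_x$; (iii) $(B_\alpha\cap\mathcal I^{\mathrm{ess}})^{-1}=B_{\alpha^{-1}}\cap\mathcal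 I^{\mathrm{ess}}$ for all $\alpha$; (iv) $B_\alpha(B_\beta\cap\mathcal I^{\mathrm{ess}})\subseteq B_{\alpha\beta}$ for all $\alpha,\beta\in\mathcal J_x$; (v) for each $\alpha\in\mathcal J_x$ there is a compact set $K_\alpha\subseteq X$ with $s(B_\alpha)=K_\alpha\cap B_x$. *)

theory Defs
  imports "HOL-Analysis.Analysis"
begin

section \<open>Higher-rank graphs\<close>

text \<open>
  Degrees live in \<^typ>\<open>nat ^ 'k\<close> with its componentwise order and operations.
  Objects and morphisms are kept apart; the usual identification of objects with
  morphisms of degree \<open>0\<close> is \<open>idm\<close>. Composition \<open>cmp \<Lambda> f g\<close> is the product \<open>fg\<close>,
  meaningful when \<open>src \<Lambda> f = rng \<Lambda> g\<close>.
\<close>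

record ('o, 'a, 'k) graded_cat =
  objs :: "'o set"
  mors :: "'a set"
  rng :: "'a \<Rightarrow> 'o"
  src :: "'a \<Rightarrow> 'o"
  idm :: "'o \<Rightarrow> 'a"
  cmp :: "'a \<Rightarrow> 'a \<Rightarrow> 'a"
  deg :: "'a \<Rightarrow> nat ^ 'k"

definition small_category :: "('o, 'a, 'k::finite) graded_cat \<Rightarrow> bool" where
  "small_category C \<longleftrightarrow>
     (\<forall>f\<in>mors C. rng C f \<in> objs C \<and> src C f \<in> objs C) \<and>
     (\<forall>v\<in>objs C. idm C v \<in> mors C \<and> rng C (idm C v) = v \<and> src C (idm C v) = v) \<and>
     (\<forall>f\<in>mors C. \<forall>g\<in>mors C. src C f = rng C g \<longrightarrow>
        cmp C f g \<in> mors C \<and> rng C (cmp C f g) = rng C f \<and> src C (cmp C f g) = src C g) \<and>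
     (\<forall>f\<in>mors C. cmp C (idm C (rng C f)) f = f \<and> cmp C f (idm C (src C f)) = f) \<and>
     (\<forall>f\<in>mors C. \<forall>g\<in>mors C. \<forall>h\<in>mors C. src C f = rng C g \<longrightarrow> src C g = rng C h \<longrightarrow>
        cmp C (cmp C f g) h = cmp C f (cmp C g h))"

definition degree_map :: "('o, 'a, 'k::finite) graded_cat \<Rightarrow> bool" where
  "degree_map C \<longleftrightarrow>
     (\<forall>v\<in>objs C. deg C (idm C v) = 0) \<and>
     (\<forall>f\<in>mors C. \<forall>g\<in>mors C. src C f = rng C g \<longrightarrow>
        deg C (cmp C f g) = deg C f + deg C g)"

definition unique_factorization :: "('o, 'a, 'k::finite) graded_cat \<Rightarrow> bool" where
  "unique_factorization C \<longleftrightarrow>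
     (\<forall>l\<in>mors C. \<forall>m n. deg C l = m + n \<longrightarrow>
        (\<exists>!p. case p of (\<mu>, \<nu>) \<Rightarrow>
           \<mu> \<in> mors C \<and> \<nu> \<in> mors C \<and> src C \<mu> = rng C \<nu> \<and>
           l = cmp C \<mu> \<nu> \<and> deg C \<mu> = m \<and> deg C \<nu> = n))"

definition k_graph :: "('o, 'a, 'k::finite) graded_cat \<Rightarrow> bool" where
  "k_graph \<Lambda> \<longleftrightarrow>
     small_category \<Lambda> \<and> countable (mors \<Lambda>) \<and> degree_map \<Lambda> \<and> unique_factorization \<Lambda>"

definition paths_from :: "('o, 'a, 'k::finite) graded_cat \<Rightarrow> 'o \<Rightarrow> nat ^ 'k \<Rightarrow> 'a set" where
  "paths_from \<Lambda> v n = {l \<in> mors \<Lambda>. deg \<Lambda> l = n \<and> rng \<Lambda> l = v}"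

definition row_finite_no_sources :: "('o, 'a, 'k::finite) graded_cat \<Rightarrow> bool" where
  "row_finite_no_sources \<Lambda> \<longleftrightarrow>
     (\<forall>v\<in>objs \<Lambda>. \<forall>n. finite (paths_from \<Lambda> v n) \<and> paths_from \<Lambda> v n \<noteq> {})"

definition Omega :: "(nat ^ 'k, (nat ^ 'k) \<times> (nat ^ 'k), 'k::finite) graded_cat" where
  "Omega = \<lparr> objs = UNIV, mors = {(m, n). m \<le> n}, rng = fst, src = snd,
     idm = (\<lambda>m. (m, m)), cmp = (\<lambda>(m, n) (n', p). (m, p)), deg = (\<lambda>(m, n). n - m) \<rparr>"

text \<open>
  A functor is given by its map on morphisms, which determines the map \<open>F0\<close> on objects.
\<close>

definition degree_functor ::
  "('o, 'a, 'k::finite) graded_cat \<Rightarrow> ('p, 'b, 'k) graded_cat \<Rightarrow> ('a \<Rightarrow> 'b) \<Rightarrow> bool" where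
  "degree_functor C D F \<longleftrightarrow>
     (\<forall>f\<in>mors C. F f \<in> mors D \<and> deg D (F f) = deg C f) \<and>
     (\<exists>F0. (\<forall>v\<in>objs C. F0 v \<in> objs D \<and> F (idm C v) = idm D (F0 v)) \<and>
           (\<forall>f\<in>mors C. rng D (F f) = F0 (rng C f) \<and> src D (F f) = F0 (src C f))) \<and>
     (\<forall>f\<in>mors C. \<forall>g\<in>mors C. src C f = rng C g \<longrightarrow> F (cmp C f g) = cmp D (F f) (F g))"

text \<open>Extensionality makes equality of functors coincide with equality of HOL functions.\<close>

type_synonym ('a, 'k) path = "(nat ^ 'k) \<times> (nat ^ 'k) \<Rightarrow> 'a"

definition infinite_paths :: "('o, 'a, 'k::finite) graded_cat \<Rightarrow> ('a, 'k) path set" where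
  "infinite_paths \<Lambda> = {x \<in> extensional (mors Omega). degree_functor Omega \<Lambda> x}"

definition cylinder :: "('o, 'a, 'k::finite) graded_cat \<Rightarrow> 'a \<Rightarrow> ('a, 'k) path set" where
  "cylinder \<Lambda> l = {x \<in> infinite_paths \<Lambda>. x (0, deg \<Lambda> l) = l}"

definition path_space :: "('o, 'a, 'k::finite) graded_cat \<Rightarrow> ('a, 'k) path topology" where
  "path_space \<Lambda> = topology_generated_by (cylinder \<Lambda> ` mors \<Lambda>)"

definition shift :: "nat ^ 'k \<Rightarrow> ('a, 'k::finite) path \<Rightarrow> ('a, 'k) path" where
  "shift p x = restrict (\<lambda>(m, n). x (m + p, n + p)) (mors Omega)"

lemma topspace_path_space: "topspace (path_space \<Lambda>) = infinite_paths \<Lambda>"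
proof
  show "topspace (path_space \<Lambda>) \<subseteq> infinite_paths \<Lambda>"
    by (auto simp: path_space_def cylinder_def)
  show "infinite_paths \<Lambda> \<subseteq> topspace (path_space \<Lambda>)"
  proof
    fix x assume x: "x \<in> infinite_paths \<Lambda>"
    then have "x (0, 0) \<in> mors \<Lambda>" "deg \<Lambda> (x (0, 0)) = 0"
      by (auto simp: infinite_paths_def degree_functor_def Omega_def)
    with x have "x \<in> cylinder \<Lambda> (x (0, 0))" "x (0, 0) \<in> mors \<Lambda>"
      by (auto simp: cylinder_def)
    then show "x \<in> topspace (path_space \<Lambda>)"
      by (auto simp: path_space_def)
  qed
qed


section \<open>Topological groupoids and isotropy\<close>

text \<open>
  The unit space is a separate type, embedded in the arrows by \<open>unt\<close>; \<open>mul\<close> is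
  meaningful on pairs with \<open>sr g = rg h\<close>.
\<close>

record ('x, 'g) top_groupoid =
  arrows :: "'g topology"
  units :: "'x topology"
  rg :: "'g \<Rightarrow> 'x"
  sr :: "'g \<Rightarrow> 'x"
  unt :: "'x \<Rightarrow> 'g"
  mul :: "'g \<Rightarrow> 'g \<Rightarrow> 'g"
  ginv :: "'g \<Rightarrow> 'g"

definition set_mul :: "('x, 'g) top_groupoid \<Rightarrow> 'g set \<Rightarrow> 'g set \<Rightarrow> 'g set" where
  "set_mul G A B = {mul G a b |a b. a \<in> A \<and> b \<in> B \<and> sr G a = rg G b}"

definition restriction :: "('x, 'g) top_groupoid \<Rightarrow> 'x set \<Rightarrow> ('x, 'g) top_groupoid" where
  "restriction G Y = G\<lparr> arrows := subtopology (arrows G) {g. rg G g \<in> Y \<and> sr G g \<in> Y},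
                        units := subtopology (units G) Y \<rparr>"

definition orbit :: "('x, 'g) top_groupoid \<Rightarrow> 'x \<Rightarrow> 'x set" where
  "orbit G x = {rg G g |g. g \<in> topspace (arrows G) \<and> sr G g = x}"

definition open_bisection :: "('x, 'g) top_groupoid \<Rightarrow> 'g set \<Rightarrow> bool" where
  "open_bisection G B \<longleftrightarrow>
     openin (arrows G) B \<and>
     openin (units G) (rg G ` B) \<and>
     homeomorphic_map (subtopology (arrows G) B) (subtopology (units G) (rg G ` B)) (rg G) \<and>
     openin (units G) (sr G ` B) \<and>
     homeomorphic_map (subtopology (arrows G) B) (subtopology (units G) (sr G ` B)) (sr G)"

definition subgroupoid :: "('x, 'g) top_groupoid \<Rightarrow> 'g set \<Rightarrow> bool" where
  "subgroupoid G H \<longleftrightarrow>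
     H \<subseteq> topspace (arrows G) \<and> set_mul G H H \<subseteq> H \<and> ginv G ` H \<subseteq> H"

definition isotropy :: "('x, 'g) top_groupoid \<Rightarrow> 'g set" where
  "isotropy G = {g \<in> topspace (arrows G). rg G g = sr G g}"

definition isotropy_at :: "('x, 'g) top_groupoid \<Rightarrow> 'x \<Rightarrow> 'g set" where
  "isotropy_at G x = {g \<in> isotropy G. sr G g = x}"

definition isotropy_interior :: "('x, 'g) top_groupoid \<Rightarrow> 'g set" where
  "isotropy_interior G = arrows G interior_of isotropy G"

definition ess_isotropy_at :: "('x, 'g) top_groupoid \<Rightarrow> 'x \<Rightarrow> 'g set" where
  "ess_isotropy_at G x =
     isotropy_interior (restriction G (units G closure_of orbit G x)) \<inter> isotropy_at G x"

definition ess_isotropy :: "('x, 'g) top_groupoid \<Rightarrow> 'g set" where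
  "ess_isotropy G = (\<Union>x\<in>topspace (units G). ess_isotropy_at G x)"

definition closed_ess_isotropy :: "('x, 'g) top_groupoid \<Rightarrow> 'g set" where
  "closed_ess_isotropy G =
     \<Inter>{H. subgroupoid G H \<and> closedin (arrows G) H \<and> ess_isotropy G \<subseteq> H}"

definition closed_ess_isotropy_at :: "('x, 'g) top_groupoid \<Rightarrow> 'x \<Rightarrow> 'g set" where
  "closed_ess_isotropy_at G x = closed_ess_isotropy G \<inter> isotropy_at G x"


section \<open>Deaconu--Renault groupoids\<close>

type_synonym ('x, 'k) dr_arrow = "'x \<times> (int ^ 'k) \<times> 'x"

definition int_diff :: "nat ^ 'k \<Rightarrow> nat ^ 'k \<Rightarrow> int ^ 'k::finite" where
  "int_diff p q = (\<chi> i. int (p $ i) - int (q $ i))"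

definition dr_basic ::
  "(nat ^ 'k \<Rightarrow> 'x \<Rightarrow> 'x) \<Rightarrow> 'x set \<Rightarrow> nat ^ 'k \<Rightarrow> nat ^ 'k \<Rightarrow> 'x set
     \<Rightarrow> ('x, 'k::finite) dr_arrow set" where
  "dr_basic T U p q V = {(x, int_diff p q, y) |x y. x \<in> U \<and> y \<in> V \<and> T p x = T q y}"

text \<open>
  The sets \<^const>\<open>dr_basic\<close> with \<open>U\<close>, \<open>V\<close> open form a basis when \<open>T\<close> is an action by local
  homeomorphisms, so the topology they generate is the one having them as a basis. Its
  underlying set consists of all \<open>(x, p - q, y)\<close> with \<open>T p x = T q y\<close> (take \<open>U = V\<close> to be
  the whole space).
\<close>

definition deaconu_renault ::
  "'x topology \<Rightarrow> (nat ^ 'k \<Rightarrow> 'x \<Rightarrow> 'x) \<Rightarrow> ('x, ('x, 'k::finite) dr_arrow) top_groupoid" where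
  "deaconu_renault X T = \<lparr>
     arrows = topology_generated_by {dr_basic T U p q V |U p q V. openin X U \<and> openin X V},
     units = X,
     rg = (\<lambda>(x, m, y). x),
     sr = (\<lambda>(x, m, y). y),
     unt = (\<lambda>x. (x, 0, x)),
     mul = (\<lambda>(x, m, y) (y', n, w). (x, m + n, w)),
     ginv = (\<lambda>(x, m, y). (y, - m, x)) \<rparr>"

lemma topspace_deaconu_renault:
  "topspace (arrows (deaconu_renault X T)) =
     {(x, int_diff p q, y) |x p q y. x \<in> topspace X \<and> y \<in> topspace X \<and> T p x = T q y}"
proof -
  have "topspace (arrows (deaconu_renault X T)) =
      \<Union>{dr_basic T U p q V |U p q V. openin X U \<and> openin X V}"
    by (simp add: deaconu_renault_def)
  also have "\<dots> = {(x, int_diff p q, y) |x p q y. x \<in> topspace X \<and> y \<in> topspace X \<and> T p x = T q y}"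
    (is "?A = ?B")
  proof
    show "?A \<subseteq> ?B"
    proof
      fix g assume "g \<in> ?A"
      then obtain U p q V where UV: "openin X U" "openin X V" and g: "g \<in> dr_basic T U p q V"
        by blast
      from UV have "U \<subseteq> topspace X" "V \<subseteq> topspace X" by (simp_all add: openin_subset)
      with g show "g \<in> ?B" unfolding dr_basic_def by blast
    qed
    show "?B \<subseteq> ?A"
    proof
      fix g assume "g \<in> ?B"
      then obtain p q where "g \<in> dr_basic T (topspace X) p q (topspace X)"
        by (auto simp: dr_basic_def)
      then show "g \<in> ?A" by blast
    qed
  qed
  finally show ?thesis .
qed

definition cocycle :: "('x, 'k::finite) dr_arrow \<Rightarrow> int ^ 'k" where
  "cocycle = (\<lambda>(x, m, y). m)"


section \<open>Harmonious families of bisections\<close>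

text \<open>
  The family is indexed by \<^term>\<open>closed_ess_isotropy_at G x\<close>; the values of \<open>B\<close> elsewhere are
  irrelevant. In the last clause \<open>sr G ` B (unt G x)\<close> is the set of units \<open>B (unt G x)\<close>
  regarded as a subset of \<open>X\<close>.
\<close>

definition harmonious_family ::
  "'x topology \<Rightarrow> (nat ^ 'k \<Rightarrow> 'x \<Rightarrow> 'x) \<Rightarrow> 'x
     \<Rightarrow> (('x, 'k::finite) dr_arrow \<Rightarrow> ('x, 'k) dr_arrow set) \<Rightarrow> bool" where
  "harmonious_family X T x B \<longleftrightarrow>
     (let G = deaconu_renault X T;
          I = ess_isotropy G;
          J = closed_ess_isotropy_at G x
      in (\<forall>\<alpha>\<in>J. open_bisection G (B \<alpha>)) \<and>
         B (unt G x) \<subseteq> unt G ` topspace X \<and>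
         (\<forall>\<alpha>\<in>J. \<alpha> \<in> B \<alpha> \<and> (\<forall>\<gamma>\<in>B \<alpha>. cocycle \<gamma> = cocycle \<alpha>)) \<and>
         (\<forall>\<alpha>\<in>J. ginv G ` (B \<alpha> \<inter> I) = B (ginv G \<alpha>) \<inter> I) \<and>
         (\<forall>\<alpha>\<in>J. \<forall>\<beta>\<in>J. set_mul G (B \<alpha>) (B \<beta> \<inter> I) \<subseteq> B (mul G \<alpha> \<beta>)) \<and>
         (\<forall>\<alpha>\<in>J. \<exists>K. compactin X K \<and> sr G ` B \<alpha> = K \<inter> sr G ` B (unt G x)))"

definition admits_harmonious_families ::
  "'x topology \<Rightarrow> (nat ^ 'k::finite \<Rightarrow> 'x \<Rightarrow> 'x) \<Rightarrow> bool" where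
  "admits_harmonious_families X T \<longleftrightarrow> (\<forall>x\<in>topspace X. \<exists>B. harmonious_family X T x B)"

end

theory Submission
  imports Defs
begin

text \<open>
  Fix an infinite path \<open>x\<close> and let \<open>A \<subseteq> \<int>\<^sup>2\<close> be its isotropy group, which contains the closed
  essential isotropy at \<open>x\<close>. The family is constructed over all of \<open>A\<close>. It suffices to find a
  partial action \<open>\<Phi>\<close> of \<open>A\<close> on a compact cylinder around \<open>x\<close>: a partial bijection \<open>\<Phi> m\<close> for each
  \<open>m \<in> A\<close>, fixing \<open>x\<close>, with \<open>\<Phi> 0\<close> the identity of the cylinder, \<open>\<Phi> (- m)\<close> the inverse of \<open>\<Phi> m\<close>, and
  \<open>\<Phi> m\<close> after \<open>\<Phi> n\<close> a restriction of \<open>\<Phi> (m + n)\<close>. If \<open>\<Phi> m\<close> is moreover a finite union of the basic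
  maps \<open>\<nu>w \<mapsto> \<mu>w\<close> with \<open>d(\<mu>) - d(\<nu>) = m\<close>, then the arrows \<open>(\<Phi> m y, m, y)\<close> form a compact open
  bisection \<open>B\<^sub>m\<close>, and even \<open>B\<^sub>m B\<^sub>n \<subseteq> B\<^bsub>m+n\<^esub>\<close>
  (\<open>harmonious_family_from_partial_action\<close>). Finite unions of basic maps are stable under
  composition and inversion (\<open>cyl_union_comp\<close>), so \<open>\<Phi>\<close> may be built by composing basic maps.

  A subgroup of \<open>\<int>\<^sup>2\<close> either is cyclic or contains a positive multiple of \<open>(1, 1)\<close>
  (\<open>int_plane_subgroup_cases\<close>); this is where rank two is used. In the cyclic case \<open>\<Phi>\<close> consists of the
  powers of one basic map (\<open>harmonious_family_cyclic\<close>). In the other case some shift \<open>y\<close> of \<open>x\<close> is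
  periodic, every element of \<open>A\<close> is a difference of elements \<open>p \<ge> 0\<close> of \<open>A\<close>, and each such \<open>p\<close>
  acts by prepending the loop \<open>y(0, p)\<close>. These maps commute and are injective, hence generate a
  partial action of \<open>A\<close>, in which \<open>p - q\<close> takes \<open>b\<close> to \<open>a\<close> whenever \<open>y(0, q) a = y(0, p) b\<close>
  (\<open>harmonious_family_periodic\<close>).
\<close>


section \<open>Degrees\<close>

lemma vec_le_iff_add: "(p :: nat ^ 'k::finite) \<le> q \<longleftrightarrow> (\<exists>r. q = p + r)"
proof
  assume "p \<le> q"
  then have "q = p + (q - p)" by (simp add: less_eq_vec_def vec_eq_iff)
  then show "\<exists>r. q = p + r" ..
qed (auto simp: less_eq_vec_def)

lemma vec_le_obtain:
  assumes "(p :: nat ^ 'k::finite) \<le> q" obtains r where "q = p + r"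
  using assms by (auto simp: vec_le_iff_add)

lemma vec_le_add [simp]: "(p :: nat ^ 'k::finite) \<le> p + r" "p \<le> r + p"
  by (auto simp: less_eq_vec_def)

lemma vec_zero_le [simp]: "(0 :: nat ^ 'k::finite) \<le> r"
  by (auto simp: less_eq_vec_def)

lemma vec_add_le_cancel [simp]:
  "(r + p :: nat ^ 'k::finite) \<le> r + q \<longleftrightarrow> p \<le> q" "p + r \<le> q + r \<longleftrightarrow> p \<le> q"
  by (auto simp: less_eq_vec_def)

lemma int_diff_zero [simp]: "int_diff p p = 0"
  by (simp add: int_diff_def vec_eq_iff)

lemma int_diff_add: "int_diff (p + p') (q + q') = int_diff p q + int_diff p' q'"
  by (simp add: int_diff_def vec_eq_iff)

lemma int_diff_swap: "int_diff q p = - int_diff p q"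
  by (simp add: int_diff_def vec_eq_iff)

lemma int_diff_eq_iff: "int_diff p q = int_diff p' q' \<longleftrightarrow> p + q' = p' + q"
proof -
  have "int a - int b = int a' - int b' \<longleftrightarrow> a + b' = a' + b" for a b a' b'
    by linarith
  then show ?thesis by (simp add: int_diff_def vec_eq_iff)
qed


section \<open>Factorization in a higher-rank graph\<close>

locale higher_rank_graph =
  fixes \<Lambda> :: "('o, 'a, 'k::finite) graded_cat"
  assumes k_graph: "k_graph \<Lambda>"
begin

definition composable :: "'a \<Rightarrow> 'a \<Rightarrow> bool" where
  "composable f g \<longleftrightarrow> f \<in> mors \<Lambda> \<and> g \<in> mors \<Lambda> \<and> src \<Lambda> f = rng \<Lambda> g"

definition is_prefix :: "'a \<Rightarrow> 'a \<Rightarrow> bool" (infix "\<sqsubseteq>" 50) where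
  "f \<sqsubseteq> l \<longleftrightarrow> (\<exists>g. composable f g \<and> l = cmp \<Lambda> f g)"

abbreviation "\<d> \<equiv> deg \<Lambda>"
abbreviation mult (infixl "\<bullet>\<bullet>" 75) where "f \<bullet>\<bullet> g \<equiv> cmp \<Lambda> f g"

lemma k_graph_axioms:
  shows category: "small_category \<Lambda>" and degree: "degree_map \<Lambda>"
    and factorization: "unique_factorization \<Lambda>"
  using k_graph by (auto simp: k_graph_def)

lemma obj_closed: "f \<in> mors \<Lambda> \<Longrightarrow> rng \<Lambda> f \<in> objs \<Lambda>" "f \<in> mors \<Lambda> \<Longrightarrow> src \<Lambda> f \<in> objs \<Lambda>"
  using category by (auto simp: small_category_def)

lemma idm_facts:
  assumes "v \<in> objs \<Lambda>"
  shows "idm \<Lambda> v \<in> mors \<Lambda>" "rng \<Lambda> (idm \<Lambda> v) = v" "src \<Lambda> (idm \<Lambda> v) = v" "\<d> (idm \<Lambda> v) = 0"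
  using category degree assms by (auto simp: small_category_def degree_map_def)

lemma cmp_facts:
  assumes "composable f g"
  shows "f \<bullet>\<bullet> g \<in> mors \<Lambda>" "rng \<Lambda> (f \<bullet>\<bullet> g) = rng \<Lambda> f" "src \<Lambda> (f \<bullet>\<bullet> g) = src \<Lambda> g"
    "\<d> (f \<bullet>\<bullet> g) = \<d> f + \<d> g"
  using category degree assms by (auto simp: small_category_def degree_map_def composable_def)

lemma cmp_idm:
  assumes "f \<in> mors \<Lambda>"
  shows "idm \<Lambda> (rng \<Lambda> f) \<bullet>\<bullet> f = f" "f \<bullet>\<bullet> idm \<Lambda> (src \<Lambda> f) = f"
  using category assms by (auto simp: small_category_def)

lemma cmp_assoc:
  assumes "composable f g" "composable g h"
  shows "f \<bullet>\<bullet> g \<bullet>\<bullet> h = f \<bullet>\<bullet> (g \<bullet>\<bullet> h)"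
proof -
  have "\<forall>f\<in>mors \<Lambda>. \<forall>g\<in>mors \<Lambda>. \<forall>h\<in>mors \<Lambda>. src \<Lambda> f = rng \<Lambda> g \<longrightarrow> src \<Lambda> g = rng \<Lambda> h \<longrightarrow>
      f \<bullet>\<bullet> g \<bullet>\<bullet> h = f \<bullet>\<bullet> (g \<bullet>\<bullet> h)"
    using category unfolding small_category_def by (elim conjE)
  with assms show ?thesis unfolding composable_def by blast
qed

lemma composable_idm:
  assumes "f \<in> mors \<Lambda>"
  shows "composable f (idm \<Lambda> (src \<Lambda> f))" "composable (idm \<Lambda> (rng \<Lambda> f)) f"
  using assms by (auto simp: composable_def idm_facts obj_closed)

lemma composable_cmp:
  assumes "composable f g"
  shows "composable (f \<bullet>\<bullet> g) h \<longleftrightarrow> composable g h" "composable h (f \<bullet>\<bullet> g) \<longleftrightarrow> composable h f"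
  using assms cmp_facts[OF assms] by (auto simp: composable_def)

lemma factor_exists:
  assumes "l \<in> mors \<Lambda>" "\<d> l = m + n"
  obtains f g where "composable f g" "l = f \<bullet>\<bullet> g" "\<d> f = m" "\<d> g = n"
proof -
  from factorization assms have "\<exists>!p. case p of (\<mu>, \<nu>) \<Rightarrow>
           \<mu> \<in> mors \<Lambda> \<and> \<nu> \<in> mors \<Lambda> \<and> src \<Lambda> \<mu> = rng \<Lambda> \<nu> \<and>
           l = cmp \<Lambda> \<mu> \<nu> \<and> \<d> \<mu> = m \<and> \<d> \<nu> = n"
    unfolding unique_factorization_def by blast
  then obtain \<mu> \<nu> where "\<mu> \<in> mors \<Lambda> \<and> \<nu> \<in> mors \<Lambda> \<and> src \<Lambda> \<mu> = rng \<Lambda> \<nu> \<and>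
           l = cmp \<Lambda> \<mu> \<nu> \<and> \<d> \<mu> = m \<and> \<d> \<nu> = n"
    by blast
  then show thesis using that[of \<mu> \<nu>] by (simp add: composable_def)
qed

lemma factor_unique:
  assumes "composable f g" "composable f' g'" "f \<bullet>\<bullet> g = f' \<bullet>\<bullet> g'" "\<d> f = \<d> f'"
  shows "f = f'" "g = g'"
proof -
  let ?P = "\<lambda>p. case p of (\<mu>, \<nu>) \<Rightarrow>
           \<mu> \<in> mors \<Lambda> \<and> \<nu> \<in> mors \<Lambda> \<and> src \<Lambda> \<mu> = rng \<Lambda> \<nu> \<and>
           f \<bullet>\<bullet> g = cmp \<Lambda> \<mu> \<nu> \<and> \<d> \<mu> = \<d> f \<and> \<d> \<nu> = \<d> g"
  have "\<d> f + \<d> g = \<d> f' + \<d> g'"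
    using cmp_facts(4)[OF assms(1)] cmp_facts(4)[OF assms(2)] assms(3) by simp
  with assms(4) have dg: "\<d> g = \<d> g'" by simp
  have "\<exists>!p. ?P p"
    using factorization cmp_facts(1,4)[OF assms(1)] unfolding unique_factorization_def by blast
  moreover have "?P (f, g)" using assms(1) by (auto simp: composable_def)
  moreover have "?P (f', g')" using assms(2,3,4) dg by (auto simp: composable_def)
  ultimately have "(f, g) = (f', g')" by blast
  then show "f = f'" "g = g'" by auto
qed

lemma deg_zero_is_idm:
  assumes "f \<in> mors \<Lambda>" "\<d> f = 0"
  shows "f = idm \<Lambda> (rng \<Lambda> f)"
  using factor_unique(1)[OF composable_idm(1)[OF assms(1)] composable_idm(2)[OF assms(1)]]
  by (simp add: cmp_idm assms idm_facts obj_closed)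

lemma prefix_mors: "f \<sqsubseteq> l \<Longrightarrow> f \<in> mors \<Lambda>" "f \<sqsubseteq> l \<Longrightarrow> l \<in> mors \<Lambda>"
  by (auto simp: is_prefix_def cmp_facts) (auto simp: composable_def)

lemma prefix_refl: "f \<in> mors \<Lambda> \<Longrightarrow> f \<sqsubseteq> f"
  unfolding is_prefix_def using composable_idm(1) cmp_idm(2) by metis

lemma prefix_deg: "f \<sqsubseteq> l \<Longrightarrow> \<d> f \<le> \<d> l"
  by (auto simp: is_prefix_def cmp_facts)

lemma prefix_rng: "f \<sqsubseteq> l \<Longrightarrow> rng \<Lambda> f = rng \<Lambda> l"
  by (auto simp: is_prefix_def cmp_facts)

lemma prefix_trans: "e \<sqsubseteq> f \<Longrightarrow> f \<sqsubseteq> l \<Longrightarrow> e \<sqsubseteq> l"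
  unfolding is_prefix_def by (metis cmp_assoc composable_cmp)

lemma prefix_cmp: "composable f g \<Longrightarrow> f \<sqsubseteq> f \<bullet>\<bullet> g"
  by (auto simp: is_prefix_def)

lemma prefix_cmp_mono:
  assumes "g \<sqsubseteq> g'" "composable f g"
  shows "f \<bullet>\<bullet> g \<sqsubseteq> f \<bullet>\<bullet> g'"
  using assms unfolding is_prefix_def by (metis cmp_assoc composable_cmp(1))

lemma prefix_exists:
  assumes "l \<in> mors \<Lambda>" "n \<le> \<d> l"
  obtains f where "f \<sqsubseteq> l" "\<d> f = n"
proof -
  obtain r where "\<d> l = n + r" using assms(2) by (rule vec_le_obtain)
  with assms(1) show thesis by (metis factor_exists is_prefix_def that)
qed

lemma prefix_unique: "f \<sqsubseteq> l \<Longrightarrow> f' \<sqsubseteq> l \<Longrightarrow> \<d> f = \<d> f' \<Longrightarrow> f = f'"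
  unfolding is_prefix_def using factor_unique(1) by metis

lemma prefix_linear:
  assumes "f \<sqsubseteq> l" "f' \<sqsubseteq> l" "\<d> f \<le> \<d> f'"
  shows "f \<sqsubseteq> f'"
proof -
  obtain e where e: "e \<sqsubseteq> f'" "\<d> e = \<d> f"
    using prefix_exists[OF prefix_mors(1)[OF assms(2)] assms(3)] by metis
  then have "e = f" using prefix_unique prefix_trans assms by metis
  with e show ?thesis by simp
qed


section \<open>Infinite paths\<close>

abbreviation "X \<equiv> infinite_paths \<Lambda>"

lemma path_extensional: "x \<in> X \<Longrightarrow> x \<in> extensional {(m, n). m \<le> n}"
  by (simp add: infinite_paths_def Omega_def)

lemma path_functor:
  assumes "x \<in> X"
  shows path_seg: "\<And>m n. m \<le> n \<Longrightarrow> x (m, n) \<in> mors \<Lambda>" "\<And>m n. m \<le> n \<Longrightarrow> \<d> (x (m, n)) = n - m"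
    and path_ends: "\<And>m n. m \<le> n \<Longrightarrow> rng \<Lambda> (x (m, n)) = rng \<Lambda> (x (m, m))"
      "\<And>m n. m \<le> n \<Longrightarrow> src \<Lambda> (x (m, n)) = rng \<Lambda> (x (n, n))"
    and path_cmp: "\<And>m n p. m \<le> n \<Longrightarrow> n \<le> p \<Longrightarrow> x (m, n) \<bullet>\<bullet> x (n, p) = x (m, p)"
proof -
  have O: "(m, n) \<in> mors Omega \<longleftrightarrow> m \<le> n" "objs Omega = UNIV" "idm Omega m = (m, m)"
    "rng Omega (m, n) = m" "src Omega (m, n) = n" "cmp Omega (m, n) (q, p) = (m, p)"
    "deg Omega (m, n) = n - m" for m n q p :: "nat ^ 'k"
    by (simp_all add: Omega_def)
  have "degree_functor Omega \<Lambda> x" using assms by (simp add: infinite_paths_def)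
  then obtain F0 where 1: "\<forall>f\<in>mors Omega. x f \<in> mors \<Lambda> \<and> \<d> (x f) = deg Omega f"
    and 2: "\<forall>v\<in>objs Omega. F0 v \<in> objs \<Lambda> \<and> x (idm Omega v) = idm \<Lambda> (F0 v)"
    and 3: "\<forall>f\<in>mors Omega. rng \<Lambda> (x f) = F0 (rng Omega f) \<and> src \<Lambda> (x f) = F0 (src Omega f)"
    and 4: "\<forall>f\<in>mors Omega. \<forall>g\<in>mors Omega. src Omega f = rng Omega g \<longrightarrow>
       x (cmp Omega f g) = x f \<bullet>\<bullet> x g"
    unfolding degree_functor_def by (elim conjE exE) rule
  {
    fix m n :: "nat ^ 'k"
    assume "m \<le> n"
    then have m: "(m, n) \<in> mors Omega" by (simp add: O)
    show "x (m, n) \<in> mors \<Lambda>" "\<d> (x (m, n)) = n - m"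
      using bspec[OF 1 m] O by simp_all
    have F: "rng \<Lambda> (x (m', n')) = F0 m' \<and> src \<Lambda> (x (m', n')) = F0 n'" if "m' \<le> n'" for m' n'
      using bspec[OF 3, of "(m', n')"] O that by simp
    show "rng \<Lambda> (x (m, n)) = rng \<Lambda> (x (m, m))" "src \<Lambda> (x (m, n)) = rng \<Lambda> (x (n, n))"
      using F[OF \<open>m \<le> n\<close>] F[of m m] F[of n n] by simp_all
    fix p :: "nat ^ 'k" assume "n \<le> p"
    then have n: "(n, p) \<in> mors Omega" by (simp add: O)
    show "x (m, n) \<bullet>\<bullet> x (n, p) = x (m, p)"
      using bspec[OF bspec[OF 4 m] n] O by simp
  }
qed

lemma pathI:
  assumes "x \<in> extensional {(m, n). m \<le> n}"
    "\<And>m. F0 m \<in> objs \<Lambda>" "\<And>m. x (m, m) = idm \<Lambda> (F0 m)"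
    "\<And>m n. m \<le> n \<Longrightarrow> x (m, n) \<in> mors \<Lambda>" "\<And>m n. m \<le> n \<Longrightarrow> \<d> (x (m, n)) = n - m"
    "\<And>m n. m \<le> n \<Longrightarrow> rng \<Lambda> (x (m, n)) = F0 m" "\<And>m n. m \<le> n \<Longrightarrow> src \<Lambda> (x (m, n)) = F0 n"
    "\<And>m n p. m \<le> n \<Longrightarrow> n \<le> p \<Longrightarrow> x (m, p) = x (m, n) \<bullet>\<bullet> x (n, p)"
  shows "x \<in> X"
proof -
  have "degree_functor Omega \<Lambda> x"
    unfolding degree_functor_def
  proof (intro conjI exI[of _ F0] ballI impI; (elim conjE)?)
    fix f :: "(nat ^ 'k) \<times> (nat ^ 'k)" assume "f \<in> mors Omega"
    then obtain m n where f: "f = (m, n)" "m \<le> n" by (auto simp: Omega_def)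
    show "x f \<in> mors \<Lambda>" "\<d> (x f) = deg Omega f" "rng \<Lambda> (x f) = F0 (rng Omega f)"
      "src \<Lambda> (x f) = F0 (src Omega f)"
      using assms(4,5,6,7)[OF f(2)] f(1) by (simp_all add: Omega_def)
    fix g :: "(nat ^ 'k) \<times> (nat ^ 'k)" assume "g \<in> mors Omega" "src Omega f = rng Omega g"
    then obtain p where "g = (n, p)" "n \<le> p" using f by (auto simp: Omega_def)
    then show "x (cmp Omega f g) = x f \<bullet>\<bullet> x g"
      using assms(8)[OF f(2), of p] f(1) by (simp add: Omega_def)
  qed (simp_all add: assms(2,3) Omega_def)
  then show ?thesis using assms(1) by (simp add: infinite_paths_def Omega_def)
qed

lemma path_seg_deg [simp]: "x \<in> X \<Longrightarrow> \<d> (x (0, n)) = n" "x \<in> X \<Longrightarrow> \<d> (x (m, m + n)) = n"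
  using path_seg[of x 0 n] path_seg[of x m "m + n"] by (auto simp: vec_eq_iff)

lemma path_composable: "x \<in> X \<Longrightarrow> m \<le> n \<Longrightarrow> n \<le> p \<Longrightarrow> composable (x (m, n)) (x (n, p))"
  by (simp add: composable_def path_seg path_ends(2)[of x m n] path_ends(1)[of x n p])

lemma path_vertex_idm: "x \<in> X \<Longrightarrow> x (m, m) = idm \<Lambda> (rng \<Lambda> (x (m, m)))"
  by (rule deg_zero_is_idm) (simp_all add: path_seg vec_eq_iff)

lemma path_prefix: "x \<in> X \<Longrightarrow> m \<le> n \<Longrightarrow> x (0, m) \<sqsubseteq> x (0, n)"
  using prefix_cmp[OF path_composable[of x 0 m n]] path_cmp[of x 0 m n] by simp

lemma path_eqI:
  assumes "x \<in> X" "y \<in> X" "\<And>n. x (0, n) = y (0, n)"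
  shows "x = y"
proof (rule extensionalityI[OF path_extensional path_extensional])
  fix mn :: "(nat ^ 'k) \<times> (nat ^ 'k)" assume "mn \<in> {(m, n). m \<le> n}"
  then obtain m n where mn: "mn = (m, n)" "m \<le> n" by auto
  have "x (m, n) = y (m, n)"
    using factor_unique(2)[OF path_composable path_composable, of x 0 m n y 0 m n]
      path_cmp[of x 0 m n] path_cmp[of y 0 m n] assms mn by simp
  then show "x mn = y mn" using mn by simp
qed (use assms in auto)

lemma path_of_prefixes:
  assumes F: "\<And>n. F n \<in> mors \<Lambda>" "\<And>n. \<d> (F n) = n" "\<And>m n. m \<le> n \<Longrightarrow> F m \<sqsubseteq> F n"
  shows "\<exists>x\<in>X. \<forall>n. x (0, n) = F n"
proof -
  have "\<forall>m n. \<exists>g. m \<le> n \<longrightarrow> composable (F m) g \<and> F n = F m \<bullet>\<bullet> g"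
    using F(3) by (auto simp: is_prefix_def)
  then obtain G where G: "\<And>m n. m \<le> n \<Longrightarrow> composable (F m) (G m n) \<and> F n = F m \<bullet>\<bullet> G m n"
    by metis
  have Gm: "G m n \<in> mors \<Lambda>" "rng \<Lambda> (G m n) = src \<Lambda> (F m)" "src \<Lambda> (G m n) = src \<Lambda> (F n)"
    if "m \<le> n" for m n
    using G[OF that] cmp_facts[of "F m" "G m n"] by (auto simp: composable_def)
  have Gd: "\<d> (G m n) = n - m" if "m \<le> n" for m n
  proof -
    have "n = m + \<d> (G m n)" using G[OF that] cmp_facts(4) F(2) by metis
    then show ?thesis by (metis add_diff_cancel_left')
  qed
  have Gc: "G m p = G m n \<bullet>\<bullet> G n p" if "m \<le> n" "n \<le> p" for m n p
  proof -
    have c: "composable (G m n) (G n p)" using Gm that by (simp add: composable_def)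
    have "m \<le> p" using that by simp
    have "F m \<bullet>\<bullet> G m p = F m \<bullet>\<bullet> (G m n \<bullet>\<bullet> G n p)"
      using G[OF \<open>m \<le> p\<close>] G[OF that(1)] G[OF that(2)] cmp_assoc[OF _ c] by metis
    then show ?thesis
      using factor_unique(2)[of "F m" "G m p" "F m" "G m n \<bullet>\<bullet> G n p"] G[OF \<open>m \<le> p\<close>] G[OF that(1)]
        composable_cmp(2)[OF c] by simp
  qed
  have Gi: "G m m = idm \<Lambda> (src \<Lambda> (F m))" for m
    using deg_zero_is_idm[of "G m m"] Gm[of m m] Gd[of m m] by (simp add: vec_eq_iff)
  define x where "x = restrict (\<lambda>(m, n). G m n) {(m, n). m \<le> n}"
  have "x \<in> X"
    by (rule pathI[of _ "\<lambda>m. src \<Lambda> (F m)"])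
      (simp_all add: x_def Gm Gd Gc[symmetric] Gi obj_closed F(1) order_trans[of _ _ "_ :: nat ^ 'k"])
  moreover have "x (0, n) = F n" for n
  proof -
    have "F 0 = idm \<Lambda> (rng \<Lambda> (F 0))" using deg_zero_is_idm F(1,2) by blast
    then have "F 0 = idm \<Lambda> (src \<Lambda> (F 0))"
      by (metis F(1) idm_facts(3) obj_closed(1))
    then have "F n = G 0 n"
      using G[of 0 n] Gm[of 0 n] cmp_idm(1)[of "G 0 n"] by simp
    then show ?thesis by (simp add: x_def)
  qed
  ultimately show ?thesis by blast
qed

text \<open>
  All infinite paths below arise as limits of directed sets of morphisms: prepending a finite path
  uses the set of its composites with the initial segments of a given path, and compactness of
  cylinders uses an increasing sequence. The initial segment of degree \<open>n\<close> may be read off from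
  any member of the set that is long enough, because a prefix of a morphism is determined
  by its degree.
\<close>

lemma path_of_directed:
  assumes S: "S \<subseteq> mors \<Lambda>"
    and dir: "\<And>f g. f \<in> S \<Longrightarrow> g \<in> S \<Longrightarrow> \<exists>h\<in>S. f \<sqsubseteq> h \<and> g \<sqsubseteq> h"
    and cof: "\<And>n. \<exists>f\<in>S. n \<le> \<d> f"
  shows "\<exists>x\<in>X. \<forall>f\<in>S. x (0, \<d> f) = f"
proof -
  have "\<forall>n. \<exists>e. \<d> e = n \<and> (\<exists>f\<in>S. e \<sqsubseteq> f)"
    using cof prefix_exists S by (metis subsetD)
  then obtain F where F: "\<And>n. \<d> (F n) = n" "\<And>n. \<exists>f\<in>S. F n \<sqsubseteq> f" by metis
  have "F m \<sqsubseteq> F n" if "m \<le> n" for m n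
    using F(1)[of m] F(1)[of n] F(2)[of m] F(2)[of n] dir that prefix_trans prefix_linear by metis
  moreover have "F n \<in> mors \<Lambda>" for n using F(2) prefix_mors by blast
  ultimately obtain x where x: "x \<in> X" "\<And>n. x (0, n) = F n"
    using path_of_prefixes[of F] F(1) by blast
  have "F (\<d> f) = f" if "f \<in> S" for f
    using F(1)[of "\<d> f"] F(2)[of "\<d> f"] dir that prefix_trans prefix_unique by metis
  then show ?thesis by (intro bexI[of _ x] ballI) (simp_all add: x)
qed

lemma shift_seg: "m \<le> n \<Longrightarrow> shift p x (m, n) = x (m + p, n + p)"
  by (simp add: shift_def Omega_def)

lemma shift_seg0: "shift p x (0, n) = x (p, p + n)"
  by (simp add: shift_seg add.commute)

lemma shift_closed:
  assumes "x \<in> X" shows "shift p x \<in> X"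
proof -
  have dd: "n + p - (m + p) = n - m" for m n :: "nat ^ 'k" by (simp add: vec_eq_iff)
  show ?thesis
  proof (rule pathI[of _ "\<lambda>m. rng \<Lambda> (x (m + p, m + p))"])
    show "shift p x \<in> extensional {(m, n). m \<le> n}" by (simp add: shift_def Omega_def)
    fix m n q :: "nat ^ 'k" assume mn: "m \<le> n" "n \<le> q"
    then have "m \<le> q" by simp
    then show "shift p x (m, q) = shift p x (m, n) \<bullet>\<bullet> shift p x (n, q)"
      using path_cmp[OF assms, of "m + p" "n + p" "q + p"] mn by (simp add: shift_seg)
    next
    fix m n :: "nat ^ 'k" assume mn: "m \<le> n"
    show "rng \<Lambda> (shift p x (m, n)) = rng \<Lambda> (x (m + p, m + p))"
      "src \<Lambda> (shift p x (m, n)) = rng \<Lambda> (x (n + p, n + p))"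
      using path_ends[OF assms, of "m + p" "n + p"] mn by (simp_all add: shift_seg)
  qed (simp_all add: shift_seg path_seg path_vertex_idm[symmetric] obj_closed assms dd)
qed

lemma shift_shift: "shift p (shift q x) = shift (p + q) x"
  by (rule ext) (auto simp: shift_def Omega_def restrict_def add.assoc)

lemma path_split: "x \<in> X \<Longrightarrow> x (0, p + n) = x (0, p) \<bullet>\<bullet> shift p x (0, n)"
  by (simp add: shift_seg0 path_cmp)

lemma path_split_composable: "x \<in> X \<Longrightarrow> composable (x (0, p)) (shift p x (0, n))"
  by (simp add: shift_seg0 path_composable)

lemma path_split_iff:
  assumes "x \<in> X" "y \<in> X"
  shows "x (0, p + n) = y (0, p + n) \<longleftrightarrow> x (0, p) = y (0, p) \<and> shift p x (0, n) = shift p y (0, n)"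
  using factor_unique[OF path_split_composable path_split_composable, of x y p n p n]
    path_split[of x p n] path_split[of y p n] assms by auto

lemma path_eq_by_shift:
  assumes "x \<in> X" "y \<in> X" "x (0, p) = y (0, p)" "shift p x = shift p y"
  shows "x = y"
proof (rule path_eqI[OF assms(1,2)])
  fix n
  have "x (0, p + n) = y (0, p + n)" using path_split_iff assms by metis
  then show "x (0, n) = y (0, n)"
    using path_split_iff[OF assms(1,2), of n p] by (simp add: add.commute)
qed

lemma prepend:
  assumes "\<mu> \<in> mors \<Lambda>" "w \<in> X" "src \<Lambda> \<mu> = rng \<Lambda> (w (0, 0))"
  shows "\<exists>z\<in>X. z (0, \<d> \<mu>) = \<mu> \<and> shift (\<d> \<mu>) z = w"
proof -
  have c: "composable \<mu> (w (0, n))" for n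
    using assms path_seg[OF assms(2), of 0 n] prefix_rng[OF path_prefix[OF assms(2), of 0 n]]
    by (simp add: composable_def)
  have "\<exists>x\<in>X. \<forall>f\<in>range (\<lambda>n. \<mu> \<bullet>\<bullet> w (0, n)). x (0, \<d> f) = f"
  proof (rule path_of_directed)
    show "range (\<lambda>n. \<mu> \<bullet>\<bullet> w (0, n)) \<subseteq> mors \<Lambda>" using cmp_facts(1)[OF c] by auto
    have "\<mu> \<bullet>\<bullet> w (0, m) \<sqsubseteq> \<mu> \<bullet>\<bullet> w (0, m + n)" "\<mu> \<bullet>\<bullet> w (0, n) \<sqsubseteq> \<mu> \<bullet>\<bullet> w (0, m + n)" for m n
      using prefix_cmp_mono c path_prefix[OF assms(2)] by simp_all
    then show "\<exists>h\<in>range (\<lambda>n. \<mu> \<bullet>\<bullet> w (0, n)). f \<sqsubseteq> h \<and> g \<sqsubseteq> h"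
      if "f \<in> range (\<lambda>n. \<mu> \<bullet>\<bullet> w (0, n))" "g \<in> range (\<lambda>n. \<mu> \<bullet>\<bullet> w (0, n))" for f g
      using that by blast
    show "\<exists>f\<in>range (\<lambda>n. \<mu> \<bullet>\<bullet> w (0, n)). n \<le> \<d> f" for n
      using cmp_facts(4)[OF c[of n]] assms(2) by (intro bexI[of _ "\<mu> \<bullet>\<bullet> w (0, n)"]) auto
  qed
  then obtain z where z: "z \<in> X" "\<And>n. z (0, \<d> \<mu> + n) = \<mu> \<bullet>\<bullet> w (0, n)"
    using cmp_facts(4)[OF c] assms(2) by auto
  have eq: "z (0, \<d> \<mu>) = \<mu> \<and> shift (\<d> \<mu>) z (0, n) = w (0, n)" for n
    using factor_unique[OF path_split_composable[OF z(1), of "\<d> \<mu>" n] c[of n]] path_split[OF z(1)] z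
    by simp
  then have "shift (\<d> \<mu>) z = w"
    by (intro path_eqI) (auto simp: shift_closed z(1) assms(2))
  with eq z show ?thesis by blast
qed

lemma vertex_of_shift:
  assumes "x \<in> X" shows "rng \<Lambda> (shift p x (0, 0)) = src \<Lambda> (x (0, p))"
  using path_split_composable[OF assms, of p 0] by (simp add: composable_def)


section \<open>Cylinders\<close>

lemma cylinder_path: "y \<in> cylinder \<Lambda> \<mu> \<Longrightarrow> y \<in> X" "y \<in> cylinder \<Lambda> \<mu> \<Longrightarrow> y (0, \<d> \<mu>) = \<mu>"
  by (simp_all add: cylinder_def)

lemma openin_cylinder: "\<mu> \<in> mors \<Lambda> \<Longrightarrow> openin (path_space \<Lambda>) (cylinder \<Lambda> \<mu>)"
  unfolding path_space_def by (rule topology_generated_by_Basis) simp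

lemma cylinder_antimono:
  assumes "\<mu> \<sqsubseteq> \<nu>" shows "cylinder \<Lambda> \<nu> \<subseteq> cylinder \<Lambda> \<mu>"
proof
  fix x assume x: "x \<in> cylinder \<Lambda> \<nu>"
  have "x (0, \<d> \<mu>) \<sqsubseteq> \<nu>"
    using path_prefix[OF cylinder_path(1)[OF x] prefix_deg[OF assms]] cylinder_path(2)[OF x] by simp
  then have "x (0, \<d> \<mu>) = \<mu>"
    using prefix_unique[OF _ assms] cylinder_path(1)[OF x] by simp
  with x show "x \<in> cylinder \<Lambda> \<mu>" by (simp add: cylinder_def)
qed

lemma path_space_basis:
  assumes "openin (path_space \<Lambda>) U" "x \<in> U"
  shows "\<exists>n. cylinder \<Lambda> (x (0, n)) \<subseteq> U"
proof -
  have "x \<in> X" using openin_subset[OF assms(1)] assms(2) by (auto simp: topspace_path_space)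
  have "generate_topology_on (cylinder \<Lambda> ` mors \<Lambda>) U"
    using assms(1) unfolding path_space_def by (rule openin_topology_generated_by)
  then show ?thesis using assms(2)
  proof induction
    case (Int a b)
    then obtain m n where "cylinder \<Lambda> (x (0, m)) \<subseteq> a" "cylinder \<Lambda> (x (0, n)) \<subseteq> b" by blast
    moreover have "cylinder \<Lambda> (x (0, m + n)) \<subseteq> cylinder \<Lambda> (x (0, m))"
      "cylinder \<Lambda> (x (0, m + n)) \<subseteq> cylinder \<Lambda> (x (0, n))"
      using cylinder_antimono[OF path_prefix[OF \<open>x \<in> X\<close>, of m "m + n"]]
        cylinder_antimono[OF path_prefix[OF \<open>x \<in> X\<close>, of n "m + n"]] by simp_all
    ultimately show ?case by blast
  next
    case (UN K)
    then show ?case by blast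
  next
    case (Basis s)
    then obtain l where "s = cylinder \<Lambda> l" "x (0, \<d> l) = l" by (auto simp: cylinder_def)
    then show ?case by (auto intro!: exI[of _ "\<d> l"])
  qed simp
qed

lemma cylinder_split:
  assumes "\<mu> \<in> mors \<Lambda>"
  shows "cylinder \<Lambda> \<mu> = (\<Union>\<kappa>\<in>paths_from \<Lambda> (src \<Lambda> \<mu>) n. cylinder \<Lambda> (\<mu> \<bullet>\<bullet> \<kappa>))"
proof
  show "(\<Union>\<kappa>\<in>paths_from \<Lambda> (src \<Lambda> \<mu>) n. cylinder \<Lambda> (\<mu> \<bullet>\<bullet> \<kappa>)) \<subseteq> cylinder \<Lambda> \<mu>"
  proof safe
    fix \<kappa> x assume \<kappa>: "\<kappa> \<in> paths_from \<Lambda> (src \<Lambda> \<mu>) n" and x: "x \<in> cylinder \<Lambda> (\<mu> \<bullet>\<bullet> \<kappa>)"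
    from \<kappa> assms have "composable \<mu> \<kappa>" by (simp add: paths_from_def composable_def)
    from cylinder_antimono[OF prefix_cmp[OF this]] x show "x \<in> cylinder \<Lambda> \<mu>" by blast
  qed
  show "cylinder \<Lambda> \<mu> \<subseteq> (\<Union>\<kappa>\<in>paths_from \<Lambda> (src \<Lambda> \<mu>) n. cylinder \<Lambda> (\<mu> \<bullet>\<bullet> \<kappa>))"
  proof
    fix x assume x: "x \<in> cylinder \<Lambda> \<mu>"
    note x' = cylinder_path[OF x]
    let ?\<kappa> = "shift (\<d> \<mu>) x (0, n)"
    have c: "composable \<mu> ?\<kappa>" using path_split_composable[OF x'(1), of "\<d> \<mu>" n] x'(2) by simp
    have "\<d> ?\<kappa> = n" using shift_closed[OF x'(1)] by simp
    with c have "?\<kappa> \<in> paths_from \<Lambda> (src \<Lambda> \<mu>) n" by (simp add: paths_from_def composable_def)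
    moreover have "x \<in> cylinder \<Lambda> (\<mu> \<bullet>\<bullet> ?\<kappa>)"
      using path_split[OF x'(1), of "\<d> \<mu>" n] x' cmp_facts(4)[OF c] \<open>\<d> ?\<kappa> = n\<close>
      by (simp add: cylinder_def)
    ultimately show "x \<in> (\<Union>\<kappa>\<in>paths_from \<Lambda> (src \<Lambda> \<mu>) n. cylinder \<Lambda> (\<mu> \<bullet>\<bullet> \<kappa>))" by blast
  qed
qed

text \<open>
  The bisection \<open>Z(\<mu>, \<nu>)\<close> with elements \<open>(\<mu>w, d(\<mu>) - d(\<nu>), \<nu>w)\<close>, stripped of its middle entry.
  Products and inverses of such bisections then become composites and converses of relations.
\<close>

definition cyl_rel :: "'a \<Rightarrow> 'a \<Rightarrow> (('a, 'k) path \<times> ('a, 'k) path) set" where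
  "cyl_rel \<mu> \<nu> = {(z, y). z \<in> cylinder \<Lambda> \<mu> \<and> y \<in> cylinder \<Lambda> \<nu> \<and> shift (\<d> \<mu>) z = shift (\<d> \<nu>) y}"

definition parallel :: "'a \<Rightarrow> 'a \<Rightarrow> bool" where
  "parallel \<mu> \<nu> \<longleftrightarrow> \<mu> \<in> mors \<Lambda> \<and> \<nu> \<in> mors \<Lambda> \<and> src \<Lambda> \<mu> = src \<Lambda> \<nu>"

lemma parallel_sym: "parallel \<mu> \<nu> \<Longrightarrow> parallel \<nu> \<mu>"
  by (simp add: parallel_def)

lemma cyl_rel_converse: "(cyl_rel \<mu> \<nu>)\<inverse> = cyl_rel \<nu> \<mu>"
  by (auto simp: cyl_rel_def)

lemma cyl_rel_single_valued: "(z, y) \<in> cyl_rel \<mu> \<nu> \<Longrightarrow> (z', y) \<in> cyl_rel \<mu> \<nu> \<Longrightarrow> z = z'"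
  using path_eq_by_shift[of z z' "\<d> \<mu>"] by (auto simp: cyl_rel_def cylinder_def)

lemma cyl_rel_total:
  assumes "parallel \<mu> \<nu>" "y \<in> cylinder \<Lambda> \<nu>"
  shows "\<exists>z. (z, y) \<in> cyl_rel \<mu> \<nu>"
proof -
  note y = cylinder_path[OF assms(2)]
  have "src \<Lambda> \<mu> = rng \<Lambda> (shift (\<d> \<nu>) y (0, 0))"
    using vertex_of_shift[OF y(1)] y(2) assms(1) by (simp add: parallel_def)
  with prepend[of \<mu> "shift (\<d> \<nu>) y"] assms(1) shift_closed[OF y(1)]
  obtain z where "z \<in> X" "z (0, \<d> \<mu>) = \<mu>" "shift (\<d> \<mu>) z = shift (\<d> \<nu>) y"
    by (auto simp: parallel_def)
  with assms(2) show ?thesis by (auto simp: cyl_rel_def cylinder_def)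
qed

lemma cyl_rel_Range: "parallel \<mu> \<nu> \<Longrightarrow> Range (cyl_rel \<mu> \<nu>) = cylinder \<Lambda> \<nu>"
  using cyl_rel_total by (fastforce simp: Range_iff cyl_rel_def)

lemma cyl_rel_Id: "cyl_rel \<mu> \<mu> = Id_on (cylinder \<Lambda> \<mu>)"
  using path_eq_by_shift by (auto simp: cyl_rel_def cylinder_def Id_on_iff) metis

text \<open>
  Splitting lengthens both morphisms by the same degree, which serves two purposes: to make the
  middle degrees of a composite agree, and to shrink a neighbourhood of an arrow.
\<close>

lemma cyl_rel_split:
  assumes "parallel \<mu> \<nu>"
  shows "cyl_rel \<mu> \<nu> = (\<Union>\<kappa>\<in>paths_from \<Lambda> (src \<Lambda> \<mu>) n. cyl_rel (\<mu> \<bullet>\<bullet> \<kappa>) (\<nu> \<bullet>\<bullet> \<kappa>))"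
proof (intro set_eqI; clarify)
  fix z y :: "('a, 'k) path"
  have c: "composable \<mu> \<kappa>" "composable \<nu> \<kappa>" "\<d> (\<mu> \<bullet>\<bullet> \<kappa>) = \<d> \<mu> + n" "\<d> (\<nu> \<bullet>\<bullet> \<kappa>) = \<d> \<nu> + n"
    if "\<kappa> \<in> paths_from \<Lambda> (src \<Lambda> \<mu>) n" for \<kappa>
    using that assms cmp_facts(4)[of \<mu> \<kappa>] cmp_facts(4)[of \<nu> \<kappa>]
    by (auto simp: paths_from_def composable_def parallel_def)
  have key: "z (0, \<d> \<mu> + n) = \<mu> \<bullet>\<bullet> \<kappa> \<longleftrightarrow> z (0, \<d> \<mu>) = \<mu> \<and> shift (\<d> \<mu>) z (0, n) = \<kappa>"
    if "composable \<mu> \<kappa>" "z \<in> X" for z \<mu> \<kappa>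
    using factor_unique[OF path_split_composable[OF that(2)] that(1), of "\<d> \<mu>" n]
      path_split[OF that(2), of "\<d> \<mu>" n] that by auto
  show "(z, y) \<in> cyl_rel \<mu> \<nu> \<longleftrightarrow>
      (z, y) \<in> (\<Union>\<kappa>\<in>paths_from \<Lambda> (src \<Lambda> \<mu>) n. cyl_rel (\<mu> \<bullet>\<bullet> \<kappa>) (\<nu> \<bullet>\<bullet> \<kappa>))" (is "?l \<longleftrightarrow> ?r")
  proof
    assume l: ?l
    then have zy: "z \<in> X" "y \<in> X" "z (0, \<d> \<mu>) = \<mu>" "y (0, \<d> \<nu>) = \<nu>"
      "shift (\<d> \<mu>) z = shift (\<d> \<nu>) y" by (auto simp: cyl_rel_def cylinder_def)
    let ?\<kappa> = "shift (\<d> \<mu>) z (0, n)"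
    have \<kappa>: "?\<kappa> \<in> paths_from \<Lambda> (src \<Lambda> \<mu>) n"
      using path_split_composable[OF zy(1), of "\<d> \<mu>" n] zy(3) path_seg_deg(1)[OF shift_closed[OF zy(1)]]
      by (simp add: paths_from_def composable_def)
    have "shift (n + \<d> \<mu>) z = shift (n + \<d> \<nu>) y" using zy(5) shift_shift by metis
    then have "(z, y) \<in> cyl_rel (\<mu> \<bullet>\<bullet> ?\<kappa>) (\<nu> \<bullet>\<bullet> ?\<kappa>)"
      using c[OF \<kappa>] key zy by (simp add: cyl_rel_def cylinder_def add.commute)
    with \<kappa> show ?r by blast
  next
    assume ?r
    then obtain \<kappa> where \<kappa>: "\<kappa> \<in> paths_from \<Lambda> (src \<Lambda> \<mu>) n" and "(z, y) \<in> cyl_rel (\<mu> \<bullet>\<bullet> \<kappa>) (\<nu> \<bullet>\<bullet> \<kappa>)"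
      by blast
    then have zy: "z \<in> X" "y \<in> X" "z (0, \<d> \<mu>) = \<mu>" "y (0, \<d> \<nu>) = \<nu>"
      "shift (\<d> \<mu>) z (0, n) = shift (\<d> \<nu>) y (0, n)"
      "shift n (shift (\<d> \<mu>) z) = shift n (shift (\<d> \<nu>) y)"
      using c[OF \<kappa>] key by (auto simp: cyl_rel_def cylinder_def shift_shift add.commute)
    then have "shift (\<d> \<mu>) z = shift (\<d> \<nu>) y"
      using path_eq_by_shift shift_closed by metis
    with zy show ?l by (simp add: cyl_rel_def cylinder_def)
  qed
qed

lemma cyl_rel_comp:
  assumes "parallel \<mu> \<nu>" "parallel \<nu> \<rho>"
  shows "cyl_rel \<mu> \<nu> O cyl_rel \<nu> \<rho> = cyl_rel \<mu> \<rho>"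
proof
  show "cyl_rel \<mu> \<nu> O cyl_rel \<nu> \<rho> \<subseteq> cyl_rel \<mu> \<rho>" by (auto simp: cyl_rel_def)
  show "cyl_rel \<mu> \<rho> \<subseteq> cyl_rel \<mu> \<nu> O cyl_rel \<nu> \<rho>"
  proof clarify
    fix z y assume zy: "(z, y) \<in> cyl_rel \<mu> \<rho>"
    then have "y \<in> cylinder \<Lambda> \<rho>" by (simp add: cyl_rel_def)
    then obtain u where u: "(u, y) \<in> cyl_rel \<nu> \<rho>" using cyl_rel_total[OF assms(2)] by blast
    with zy have "(z, u) \<in> cyl_rel \<mu> \<nu>" by (auto simp: cyl_rel_def)
    with u show "(z, y) \<in> cyl_rel \<mu> \<nu> O cyl_rel \<nu> \<rho>" by blast
  qed
qed

lemma cyl_rel_comp_disjoint: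
  assumes "\<nu> \<noteq> \<nu>'" "\<d> \<nu> = \<d> \<nu>'"
  shows "cyl_rel \<mu> \<nu> O cyl_rel \<nu>' \<rho> = {}"
  using assms by (auto simp: cyl_rel_def cylinder_def)

end

locale row_finite_graph = higher_rank_graph \<Lambda>
  for \<Lambda> :: "('o, 'a, 'k::finite) graded_cat" +
  assumes row_finite: "row_finite_no_sources \<Lambda>"
begin

lemma finite_paths_from: "\<mu> \<in> mors \<Lambda> \<Longrightarrow> finite (paths_from \<Lambda> (src \<Lambda> \<mu>) n)"
  using row_finite obj_closed by (auto simp: row_finite_no_sources_def)

text \<open>
  Koenig's lemma: a cylinder without finite subcover contains, by row-finiteness, a
  cylinder of larger degree without finite subcover. The resulting increasing sequence of
  morphisms converges to an infinite path, and a member of the cover around that path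
  swallows one of the cylinders in the sequence.
\<close>

lemma compactin_cylinder:
  assumes "\<mu> \<in> mors \<Lambda>"
  shows "compactin (path_space \<Lambda>) (cylinder \<Lambda> \<mu>)"
  unfolding compactin_def
proof (intro conjI allI impI; (elim conjE)?)
  show "cylinder \<Lambda> \<mu> \<subseteq> topspace (path_space \<Lambda>)"
    by (auto simp: topspace_path_space cylinder_def)
  fix \<U> assume \<U>: "\<forall>U\<in>\<U>. openin (path_space \<Lambda>) U" and cover: "cylinder \<Lambda> \<mu> \<subseteq> \<Union>\<U>"
  define bad where "bad l \<longleftrightarrow> l \<in> mors \<Lambda> \<and> (\<nexists>\<F>. finite \<F> \<and> \<F> \<subseteq> \<U> \<and> cylinder \<Lambda> l \<subseteq> \<Union>\<F>)" for l
  have step: "\<exists>l'. bad l' \<and> l \<sqsubseteq> l' \<and> \<d> l' = \<d> l + 1" if "bad l" for l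
  proof (rule ccontr)
    assume no: "\<nexists>l'. bad l' \<and> l \<sqsubseteq> l' \<and> \<d> l' = \<d> l + 1"
    have l: "l \<in> mors \<Lambda>" using that by (simp add: bad_def)
    have "\<forall>\<kappa>\<in>paths_from \<Lambda> (src \<Lambda> l) 1. \<exists>\<F>. finite \<F> \<and> \<F> \<subseteq> \<U> \<and> cylinder \<Lambda> (l \<bullet>\<bullet> \<kappa>) \<subseteq> \<Union>\<F>"
    proof
      fix \<kappa> assume "\<kappa> \<in> paths_from \<Lambda> (src \<Lambda> l) 1"
      with l have c: "composable l \<kappa>" "\<d> \<kappa> = 1" by (auto simp: composable_def paths_from_def)
      with no have "\<not> bad (l \<bullet>\<bullet> \<kappa>)" using prefix_cmp cmp_facts(4)[OF c(1)] by auto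
      then show "\<exists>\<F>. finite \<F> \<and> \<F> \<subseteq> \<U> \<and> cylinder \<Lambda> (l \<bullet>\<bullet> \<kappa>) \<subseteq> \<Union>\<F>"
        using cmp_facts(1)[OF c(1)] unfolding bad_def by blast
    qed
    then obtain F where F: "\<And>\<kappa>. \<kappa> \<in> paths_from \<Lambda> (src \<Lambda> l) 1 \<Longrightarrow>
        finite (F \<kappa>) \<and> F \<kappa> \<subseteq> \<U> \<and> cylinder \<Lambda> (l \<bullet>\<bullet> \<kappa>) \<subseteq> \<Union>(F \<kappa>)"
      by metis
    let ?F = "\<Union>\<kappa>\<in>paths_from \<Lambda> (src \<Lambda> l) 1. F \<kappa>"
    have "finite ?F" using F finite_paths_from[OF l] by blast
    moreover have "?F \<subseteq> \<U>" using F by blast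
    moreover have "cylinder \<Lambda> l \<subseteq> \<Union>?F"
      unfolding cylinder_split[OF l, of 1]
    proof (rule UN_least)
      fix \<kappa> assume \<kappa>: "\<kappa> \<in> paths_from \<Lambda> (src \<Lambda> l) 1"
      then have "cylinder \<Lambda> (l \<bullet>\<bullet> \<kappa>) \<subseteq> \<Union>(F \<kappa>)" using F by simp
      with \<kappa> show "cylinder \<Lambda> (l \<bullet>\<bullet> \<kappa>) \<subseteq> \<Union>?F" by blast
    qed
    ultimately show False using that unfolding bad_def by blast
  qed
  show "\<exists>\<F>. finite \<F> \<and> \<F> \<subseteq> \<U> \<and> cylinder \<Lambda> \<mu> \<subseteq> \<Union>\<F>"
  proof (rule ccontr)
    assume "\<not> ?thesis"
    then have "bad \<mu>" using assms by (simp add: bad_def)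
    define g where "g l = (SOME l'. bad l' \<and> l \<sqsubseteq> l' \<and> \<d> l' = \<d> l + 1)" for l
    have g: "bad (g l) \<and> l \<sqsubseteq> g l \<and> \<d> (g l) = \<d> l + 1" if "bad l" for l
      using someI_ex[OF step[OF that]] unfolding g_def .
    define L where "L i = (g ^^ i) \<mu>" for i
    have "bad (L i)" for i by (induction i) (simp_all add: L_def g \<open>bad \<mu>\<close>)
    then have L: "L 0 = \<mu>" "\<And>i. bad (L i)" "\<And>i. L i \<sqsubseteq> L (Suc i) \<and> \<d> (L (Suc i)) = \<d> (L i) + 1"
      using g by (simp_all add: L_def)
    have Lm: "L i \<in> mors \<Lambda>" for i using L(2) by (simp add: bad_def)
    have Lp: "L i \<sqsubseteq> L (i + j)" for i j
      by (induction j) (use prefix_refl[OF Lm] L(3) prefix_trans in auto)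
    have Ld: "i \<le> \<d> (L i) $ c" for i c
      by (induction i) (simp_all add: L(3))
    have cofinal: "\<exists>i. n \<le> \<d> (L i)" for n
    proof
      have "n $ c \<le> (\<Sum>c\<in>UNIV. n $ c)" for c by (rule member_le_sum) auto
      then show "n \<le> \<d> (L (\<Sum>c\<in>UNIV. n $ c))"
        unfolding less_eq_vec_def using Ld order_trans by blast
    qed
    have "\<exists>x\<in>X. \<forall>f\<in>range L. x (0, \<d> f) = f"
    proof (rule path_of_directed)
      show "\<exists>h\<in>range L. f \<sqsubseteq> h \<and> g \<sqsubseteq> h" if "f \<in> range L" "g \<in> range L" for f g
        using that Lp by (metis add.commute imageE rangeI)
      show "\<exists>f\<in>range L. n \<le> \<d> f" for n using cofinal by blast
    qed (use Lm in auto)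
    then obtain x where x: "x \<in> X" "\<And>i. x (0, \<d> (L i)) = L i" by auto
    have "x \<in> cylinder \<Lambda> \<mu>" using x(1) x(2)[of 0] L(1) by (simp add: cylinder_def)
    then obtain U where U: "U \<in> \<U>" "x \<in> U" using cover by blast
    then obtain n where n: "cylinder \<Lambda> (x (0, n)) \<subseteq> U" using path_space_basis \<U> by blast
    obtain i where "n \<le> \<d> (L i)" using cofinal by blast
    then have "x (0, n) \<sqsubseteq> L i" using path_prefix[OF x(1)] x(2) by metis
    then have "cylinder \<Lambda> (L i) \<subseteq> U" using cylinder_antimono n by blast
    then have "\<not> bad (L i)" using U(1) unfolding bad_def by (auto intro!: exI[of _ "{U}"])
    then show False using L(2) by blast
  qed
qed

text \<open>
  Finite unions of basic relations that share the cocycle value \<open>m\<close>. They stand for the compact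
  open subsets of the fibre of the cocycle over \<open>m\<close>, and the point of the notion is that it is
  stable under products and inverses, so that bisections may be produced by algebra alone.
\<close>

inductive cyl_union :: "int ^ 'k \<Rightarrow> (('a, 'k) path \<times> ('a, 'k) path) set \<Rightarrow> bool"
  for m where
  empty: "cyl_union m {}"
| insert: "cyl_union m R \<Longrightarrow> parallel \<mu> \<nu> \<Longrightarrow> int_diff (\<d> \<mu>) (\<d> \<nu>) = m
    \<Longrightarrow> cyl_union m (cyl_rel \<mu> \<nu> \<union> R)"

lemma cyl_union_basic: "parallel \<mu> \<nu> \<Longrightarrow> int_diff (\<d> \<mu>) (\<d> \<nu>) = m \<Longrightarrow> cyl_union m (cyl_rel \<mu> \<nu>)"
  using cyl_union.insert[OF cyl_union.empty] by simp

lemma cyl_union_Un: "cyl_union m R \<Longrightarrow> cyl_union m R' \<Longrightarrow> cyl_union m (R \<union> R')"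
  by (induction R rule: cyl_union.induct) (simp_all add: cyl_union.insert Un_assoc)

lemma cyl_union_UN:
  assumes "finite I" "\<And>i. i \<in> I \<Longrightarrow> cyl_union m (R i)" shows "cyl_union m (\<Union>i\<in>I. R i)"
  using assms by (induction I rule: finite_induct) (simp_all add: cyl_union.empty cyl_union_Un)

lemma cyl_union_converse: "cyl_union m R \<Longrightarrow> cyl_union (- m) (R\<inverse>)"
proof (induction R rule: cyl_union.induct)
  case (insert R \<mu> \<nu>)
  have "(cyl_rel \<mu> \<nu> \<union> R)\<inverse> = cyl_rel \<nu> \<mu> \<union> R\<inverse>"
    by (simp add: converse_Un cyl_rel_converse)
  moreover have "int_diff (\<d> \<nu>) (\<d> \<mu>) = - m"
    using insert.hyps(3) int_diff_swap by metis
  ultimately show ?case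
    using cyl_union.insert[OF insert.IH parallel_sym[OF insert.hyps(2)]] by simp
qed (simp add: cyl_union.empty)

text \<open>
  If the two middle morphisms have equal degree, their cylinders coincide or are disjoint, and
  the composite is a basic relation or empty. Extending \<open>\<nu>\<close> by the degree of \<open>\<nu>'\<close> and vice versa
  makes the degrees equal, at the price of a finite union.
\<close>

lemma cyl_union_comp_basic:
  assumes "parallel \<mu> \<nu>" "parallel \<nu>' \<rho>" "int_diff (\<d> \<mu>) (\<d> \<nu>) = m" "int_diff (\<d> \<nu>') (\<d> \<rho>) = n"
  shows "cyl_union (m + n) (cyl_rel \<mu> \<nu> O cyl_rel \<nu>' \<rho>)"
proof -
  let ?K = "paths_from \<Lambda> (src \<Lambda> \<mu>) (\<d> \<nu>')" and ?K' = "paths_from \<Lambda> (src \<Lambda> \<nu>') (\<d> \<nu>)"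
  have K: "composable \<mu> \<kappa> \<and> composable \<nu> \<kappa> \<and> \<d> \<kappa> = \<d> \<nu>'" if "\<kappa> \<in> ?K" for \<kappa>
    using that assms(1) by (auto simp: paths_from_def composable_def parallel_def)
  have K': "composable \<nu>' \<kappa> \<and> composable \<rho> \<kappa> \<and> \<d> \<kappa> = \<d> \<nu>" if "\<kappa> \<in> ?K'" for \<kappa>
    using that assms(2) by (auto simp: paths_from_def composable_def parallel_def)
  have fin: "finite ?K" "finite ?K'"
    using finite_paths_from assms(1,2) by (auto simp: parallel_def)
  have "cyl_union (m + n) (cyl_rel (\<mu> \<bullet>\<bullet> \<kappa>) (\<nu> \<bullet>\<bullet> \<kappa>) O cyl_rel (\<nu>' \<bullet>\<bullet> \<kappa>') (\<rho> \<bullet>\<bullet> \<kappa>'))"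
    if "\<kappa> \<in> ?K" "\<kappa>' \<in> ?K'" for \<kappa> \<kappa>'
  proof (cases "\<nu> \<bullet>\<bullet> \<kappa> = \<nu>' \<bullet>\<bullet> \<kappa>'")
    case True
    have p: "parallel (\<mu> \<bullet>\<bullet> \<kappa>) (\<nu> \<bullet>\<bullet> \<kappa>)" "parallel (\<nu>' \<bullet>\<bullet> \<kappa>') (\<rho> \<bullet>\<bullet> \<kappa>')"
      using K[OF that(1)] K'[OF that(2)] by (simp_all add: parallel_def cmp_facts)
    then have "parallel (\<mu> \<bullet>\<bullet> \<kappa>) (\<rho> \<bullet>\<bullet> \<kappa>')" using True by (simp add: parallel_def)
    moreover have "int_diff (\<d> (\<mu> \<bullet>\<bullet> \<kappa>)) (\<d> (\<rho> \<bullet>\<bullet> \<kappa>')) = m + n"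
      using K[OF that(1)] K'[OF that(2)] assms(3,4) int_diff_add[of "\<d> \<mu>" "\<d> \<nu>'" "\<d> \<nu>" "\<d> \<rho>"]
      by (simp add: cmp_facts add.commute)
    ultimately show ?thesis using cyl_rel_comp[OF p(1)] p(2) True cyl_union_basic by simp
  next
    case False
    then have "cyl_rel (\<mu> \<bullet>\<bullet> \<kappa>) (\<nu> \<bullet>\<bullet> \<kappa>) O cyl_rel (\<nu>' \<bullet>\<bullet> \<kappa>') (\<rho> \<bullet>\<bullet> \<kappa>') = {}"
      using K[OF that(1)] K'[OF that(2)]
      by (intro cyl_rel_comp_disjoint) (simp_all add: cmp_facts add.commute)
    then show ?thesis by (simp add: cyl_union.empty)
  qed
  moreover have "cyl_rel \<mu> \<nu> O cyl_rel \<nu>' \<rho> =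
      (\<Union>\<kappa>\<in>?K. \<Union>\<kappa>'\<in>?K'. cyl_rel (\<mu> \<bullet>\<bullet> \<kappa>) (\<nu> \<bullet>\<bullet> \<kappa>) O cyl_rel (\<nu>' \<bullet>\<bullet> \<kappa>') (\<rho> \<bullet>\<bullet> \<kappa>'))"
    unfolding cyl_rel_split[OF assms(1), of "\<d> \<nu>'"] cyl_rel_split[OF assms(2), of "\<d> \<nu>"]
    unfolding relcomp_UNION_distrib relcomp_UNION_distrib2 by (rule SUP_commute)
  ultimately show ?thesis using fin by (auto intro!: cyl_union_UN)
qed

lemma cyl_union_comp:
  assumes "cyl_union m R" "cyl_union n R'" shows "cyl_union (m + n) (R O R')"
  using assms(1)
proof (induction R rule: cyl_union.induct)
  case (insert R \<mu> \<nu>)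
  from assms(2) have "cyl_union (m + n) (cyl_rel \<mu> \<nu> O R')"
  proof (induction R' rule: cyl_union.induct)
    case (insert R' \<nu>' \<rho>)
    then show ?case
      using cyl_union_comp_basic[OF \<open>parallel \<mu> \<nu>\<close>] \<open>int_diff (\<d> \<mu>) (\<d> \<nu>) = m\<close>
      by (simp add: relcomp_distrib cyl_union_Un)
  qed (simp add: cyl_union.empty)
  with insert.IH show ?case by (simp add: relcomp_distrib2 cyl_union_Un)
qed (simp add: cyl_union.empty)

lemma compactin_cyl_union_Range: "cyl_union m R \<Longrightarrow> compactin (path_space \<Lambda>) (Range R)"
proof (induction R rule: cyl_union.induct)
  case (insert R \<mu> \<nu>)
  then show ?case
    by (simp add: Range_Un_eq cyl_rel_Range compactin_Un compactin_cylinder parallel_def)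
qed simp

end


section \<open>Inversion, range and source in a Deaconu--Renault groupoid\<close>

lemma deaconu_renault_simps [simp]:
  "rg (deaconu_renault Y T) (x, m, y) = x"
  "sr (deaconu_renault Y T) (x, m, y) = y"
  "units (deaconu_renault Y T) = Y"
  "unt (deaconu_renault Y T) x = (x, 0, x)"
  "mul (deaconu_renault Y T) (x, m, y) (y', n, w) = (x, m + n, w)"
  "ginv (deaconu_renault Y T) (x, m, y) = (y, - m, x)"
  by (simp_all add: deaconu_renault_def)

lemma cocycle_simp [simp]: "cocycle (x, m, y) = m"
  by (simp add: cocycle_def)

lemma ginv_ginv [simp]: "ginv (deaconu_renault Y T) (ginv (deaconu_renault Y T) g) = g"
  by (cases g) simp

lemma rg_ginv [simp]: "rg (deaconu_renault Y T) (ginv (deaconu_renault Y T) g) = sr (deaconu_renault Y T) g"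
  and sr_ginv [simp]: "sr (deaconu_renault Y T) (ginv (deaconu_renault Y T) g) = rg (deaconu_renault Y T) g"
  by (cases g; simp)+

lemma openin_dr_basic:
  "openin Y U \<Longrightarrow> openin Y V \<Longrightarrow> openin (arrows (deaconu_renault Y T)) (dr_basic T U p q V)"
  unfolding deaconu_renault_def by (auto intro!: topology_generated_by_Basis)

lemma openin_ginv:
  assumes "openin (arrows (deaconu_renault Y T)) W"
  shows "openin (arrows (deaconu_renault Y T)) (ginv (deaconu_renault Y T) ` W)"
proof -
  let ?inv = "ginv (deaconu_renault Y T)"
  have inj: "inj ?inv" by (metis ginv_ginv injI)
  have "generate_topology_on {dr_basic T U p q V |U p q V. openin Y U \<and> openin Y V} W"
    using assms by (simp add: deaconu_renault_def openin_topology_generated_by)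
  then show ?thesis
  proof induction
    case (Int a b)
    then show ?case by (simp add: image_Int[OF inj] openin_Int)
  next
    case (UN K)
    then show ?case by (auto simp: image_Union intro!: openin_Union)
  next
    case (Basis s)
    then obtain U p q V where s: "s = dr_basic T U p q V" "openin Y U" "openin Y V" by blast
    have "?inv ` s = dr_basic T V q p U"
      unfolding s(1) dr_basic_def by (force simp: image_iff int_diff_swap[of q p])
    with s show ?case by (simp add: openin_dr_basic)
  qed simp
qed

text \<open>
  Inversion is a homeomorphism that preserves the restriction to any set of units and
  the isotropy group at each unit, hence also the interior of the isotropy.
\<close>

lemma ess_isotropy_ginv:
  assumes "g \<in> ess_isotropy (deaconu_renault Y T)"
  shows "ginv (deaconu_renault Y T) g \<in> ess_isotropy (deaconu_renault Y T)"
proof -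
  define G where "G = deaconu_renault Y T"
  have G: "ginv G (ginv G g) = g" "rg G (ginv G g) = sr G g" "sr G (ginv G g) = rg G g"
    "openin (arrows G) W \<Longrightarrow> openin (arrows G) (ginv G ` W)" for g W
    by (simp_all add: G_def openin_ginv)
  obtain x where x: "x \<in> topspace (units G)" "g \<in> isotropy_at G x"
    "g \<in> isotropy_interior (restriction G (units G closure_of orbit G x))"
    using assms unfolding ess_isotropy_def ess_isotropy_at_def G_def by blast
  define Z where "Z = units G closure_of orbit G x"
  obtain T where T: "openin (subtopology (arrows G) {g. rg G g \<in> Z \<and> sr G g \<in> Z}) T"
    "g \<in> T" "T \<subseteq> isotropy (restriction G Z)"
    using x(3) by (auto simp: isotropy_interior_def interior_of_def restriction_def Z_def)
  obtain W where W: "openin (arrows G) W" "T = W \<inter> {g. rg G g \<in> Z \<and> sr G g \<in> Z}"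
    using T(1) by (auto simp: openin_subtopology)
  have T': "ginv G ` T = ginv G ` W \<inter> {g. rg G g \<in> Z \<and> sr G g \<in> Z}"
    unfolding W(2) using G(1,2,3) by (auto simp: image_iff)
  have "openin (subtopology (arrows G) {g. rg G g \<in> Z \<and> sr G g \<in> Z}) (ginv G ` T)"
    using G(4)[OF W(1)] T' by (auto simp: openin_subtopology)
  moreover have "ginv G ` T \<subseteq> isotropy (restriction G Z)"
  proof -
    have "rg G h = sr G h" if "h \<in> T" for h
      using T(3) that by (auto simp: isotropy_def restriction_def)
    moreover have "ginv G ` T \<subseteq> topspace (arrows G) \<inter> {g. rg G g \<in> Z \<and> sr G g \<in> Z}"
      using T' openin_subset[OF G(4)[OF W(1)]] by auto
    ultimately show ?thesis by (auto simp: isotropy_def restriction_def G)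
  qed
  ultimately have "ginv G g \<in> isotropy_interior (restriction G Z)"
    using T(2) unfolding isotropy_interior_def interior_of_def restriction_def by auto
  moreover have "ginv G g \<in> isotropy_at G x"
    using x(2) openin_subset[OF G(4)[OF openin_topspace]]
    by (auto simp: isotropy_at_def isotropy_def G)
  ultimately show ?thesis
    using x(1) unfolding ess_isotropy_def ess_isotropy_at_def G_def[symmetric] Z_def by blast
qed

lemma continuous_map_rg_sr:
  fixes Y :: "'x topology" and T :: "nat ^ 'k::finite \<Rightarrow> 'x \<Rightarrow> 'x"
  defines "G \<equiv> deaconu_renault Y T"
  shows "continuous_map (arrows G) Y (rg G)" "continuous_map (arrows G) Y (sr G)"
proof -
  have top: "(z, m, y) \<in> topspace (arrows G) \<longleftrightarrow> z \<in> topspace Y \<and> y \<in> topspace Y \<and>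
      (\<exists>p q. m = int_diff p q \<and> T p z = T q y)" for z m y
    by (auto simp: G_def topspace_deaconu_renault)
  have basic: "(z, m, y) \<in> dr_basic T U p q V \<longleftrightarrow> z \<in> U \<and> y \<in> V \<and> m = int_diff p q \<and> T p z = T q y"
    for z m y p q U V by (auto simp: dr_basic_def)
  have pre: "{g \<in> topspace (arrows G). rg G g \<in> U} = (\<Union>p q. dr_basic T U p q (topspace Y))"
    "{g \<in> topspace (arrows G). sr G g \<in> U} = (\<Union>p q. dr_basic T (topspace Y) p q U)"
    if "openin Y U" for U
    using openin_subset[OF that] by (auto simp: top basic) (auto simp: G_def)
  have maps: "rg G \<in> topspace (arrows G) \<rightarrow> topspace Y" "sr G \<in> topspace (arrows G) \<rightarrow> topspace Y"
    by (auto simp: top) (auto simp: G_def)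
  have op: "openin (arrows G) (\<Union>p q. dr_basic T U p q V)" if "openin Y U" "openin Y V" for U V
    unfolding G_def using that by (intro openin_Union ballI; elim imageE; simp)+ (auto intro!: openin_dr_basic)
  show "continuous_map (arrows G) Y (rg G)" "continuous_map (arrows G) Y (sr G)"
    unfolding continuous_map_def using maps pre op by simp_all
qed

context higher_rank_graph
begin

abbreviation "G \<equiv> deaconu_renault (path_space \<Lambda>) (shift :: nat ^ 'k \<Rightarrow> ('a, 'k) path \<Rightarrow> ('a, 'k) path)"

definition lift_rel :: "int ^ 'k \<Rightarrow> (('a, 'k) path \<times> ('a, 'k) path) set \<Rightarrow> (('a, 'k) path, 'k) dr_arrow set"
  where "lift_rel m R = {(z, m, y) |z y. (z, y) \<in> R}"

lemma lift_rel_iff [simp]: "(z, m', y) \<in> lift_rel m R \<longleftrightarrow> m' = m \<and> (z, y) \<in> R"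
  by (auto simp: lift_rel_def)

lemma openin_lift_cyl_rel:
  assumes "parallel \<mu> \<nu>"
  shows "openin (arrows G) (lift_rel (int_diff (\<d> \<mu>) (\<d> \<nu>)) (cyl_rel \<mu> \<nu>))"
proof -
  have "lift_rel (int_diff (\<d> \<mu>) (\<d> \<nu>)) (cyl_rel \<mu> \<nu>)
      = dr_basic shift (cylinder \<Lambda> \<mu>) (\<d> \<mu>) (\<d> \<nu>) (cylinder \<Lambda> \<nu>)"
    by (auto simp: lift_rel_def cyl_rel_def dr_basic_def)
  then show ?thesis using assms by (simp add: openin_dr_basic openin_cylinder parallel_def)
qed

lemma parallel_paths:
  assumes "z \<in> X" "y \<in> X" "shift p z = shift q y"
  shows "parallel (z (0, p)) (y (0, q))"
  using vertex_of_shift[OF assms(1), of p] vertex_of_shift[OF assms(2), of q] assms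
  by (simp add: parallel_def path_seg)

lemma cyl_rel_antimono:
  assumes "z \<in> X" "y \<in> X" "shift p z = shift q y"
  shows "cyl_rel (z (0, p + l)) (y (0, q + l)) \<subseteq> cyl_rel (z (0, p)) (y (0, q))"
proof -
  have c: "composable (z (0, p)) (shift p z (0, l))" by (rule path_split_composable[OF assms(1)])
  then have "shift p z (0, l) \<in> paths_from \<Lambda> (src \<Lambda> (z (0, p))) l"
    using path_seg_deg(1)[OF shift_closed[OF assms(1)]] by (simp add: paths_from_def composable_def)
  moreover have "z (0, p + l) = z (0, p) \<bullet>\<bullet> shift p z (0, l)" "y (0, q + l) = y (0, q) \<bullet>\<bullet> shift p z (0, l)"
    using path_split[OF assms(1)] path_split[OF assms(2)] assms(3) by simp_all
  ultimately show ?thesis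
    unfolding cyl_rel_split[OF parallel_paths[OF assms], of l] by auto
qed

text \<open>
  The generating sets of the topology involve a pair \<open>(p, q)\<close> with \<open>p - q = m\<close>, and an arrow
  \<open>(z, m, y)\<close> lies in generating sets for different pairs. Raising \<open>p\<close> and \<open>q\<close> by the same amount
  shrinks the basic neighbourhood of the arrow, and any two pairs with the same difference
  become equal after such a change; this is why the neighbourhoods below form a basis at
  \<open>(z, m, y)\<close> and not just a subbasis.
\<close>

lemma arrows_basis:
  assumes "openin (arrows G) W" "(z, m, y) \<in> W"
  shows "z \<in> X \<and> y \<in> X \<and> (\<exists>p q. m = int_diff p q \<and> shift p z = shift q y \<and>
     lift_rel m (cyl_rel (z (0, p)) (y (0, q))) \<subseteq> W)"
proof
  show z: "z \<in> X"
    using openin_subset[OF assms(1)] assms(2)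
    by (auto simp: topspace_deaconu_renault topspace_path_space)
  have y: "y \<in> X"
    using openin_subset[OF assms(1)] assms(2)
    by (auto simp: topspace_deaconu_renault topspace_path_space)
  have "generate_topology_on {dr_basic shift U p q V |U p q V.
      openin (path_space \<Lambda>) U \<and> openin (path_space \<Lambda>) V} W"
    using assms(1) by (simp add: deaconu_renault_def openin_topology_generated_by)
  then have "\<exists>p q. m = int_diff p q \<and> shift p z = shift q y \<and>
     lift_rel m (cyl_rel (z (0, p)) (y (0, q))) \<subseteq> W"
    using assms(2)
  proof induction
    case (Int a b)
    then obtain p q p' q' where
      pq: "m = int_diff p q" "shift p z = shift q y" "lift_rel m (cyl_rel (z (0, p)) (y (0, q))) \<subseteq> a"
      and pq': "m = int_diff p' q'" "shift p' z = shift q' y"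
        "lift_rel m (cyl_rel (z (0, p')) (y (0, q'))) \<subseteq> b"
      by blast
    have q: "q + p' = q' + p" using pq(1) pq'(1) int_diff_eq_iff[of p q p' q'] by (simp add: add.commute)
    have "cyl_rel (z (0, p + p')) (y (0, q + p')) \<subseteq> cyl_rel (z (0, p)) (y (0, q))"
      by (rule cyl_rel_antimono[OF z y pq(2)])
    moreover have "cyl_rel (z (0, p + p')) (y (0, q + p')) \<subseteq> cyl_rel (z (0, p')) (y (0, q'))"
      using cyl_rel_antimono[OF z y pq'(2), of p] q by (simp add: add.commute)
    ultimately have "lift_rel m (cyl_rel (z (0, p + p')) (y (0, q + p'))) \<subseteq> a \<inter> b"
      using pq(3) pq'(3) by (fastforce simp: lift_rel_def)
    moreover have "shift (p + p') z = shift (q + p') y"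
      using pq(2) by (metis add.commute shift_shift)
    moreover have "m = int_diff (p + p') (q + p')" by (simp add: int_diff_add pq(1))
    ultimately show ?case by blast
  next
    case (UN K)
    then obtain k where k: "k \<in> K" "(z, m, y) \<in> k" by blast
    from UN.IH[OF k] k(1) show ?case by blast
  next
    case (Basis s)
    then obtain U p q V where s: "s = dr_basic shift U p q V"
      "openin (path_space \<Lambda>) U" "openin (path_space \<Lambda>) V" by blast
    then have pq: "z \<in> U" "y \<in> V" "m = int_diff p q" "shift p z = shift q y"
      using Basis.prems by (auto simp: dr_basic_def)
    obtain n n' where n: "cylinder \<Lambda> (z (0, n)) \<subseteq> U" "cylinder \<Lambda> (y (0, n')) \<subseteq> V"
      using path_space_basis s pq by metis
    let ?l = "n + n'"
    have "n \<le> p + ?l" "n' \<le> q + ?l" by (simp_all add: less_eq_vec_def)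
    then have "cylinder \<Lambda> (z (0, p + ?l)) \<subseteq> U" "cylinder \<Lambda> (y (0, q + ?l)) \<subseteq> V"
      using n cylinder_antimono[OF path_prefix[OF z]] cylinder_antimono[OF path_prefix[OF y]] by blast+
    then have "(z', y') \<in> cyl_rel (z (0, p + ?l)) (y (0, q + ?l)) \<Longrightarrow> (z', m, y') \<in> s" for z' y'
      using cyl_rel_antimono[OF z y pq(4), of ?l] pq(3) z y
      unfolding s(1) dr_basic_def by (auto simp: cyl_rel_def)
    then have "lift_rel m (cyl_rel (z (0, p + ?l)) (y (0, q + ?l))) \<subseteq> s"
      by (auto simp: lift_rel_def)
    moreover have "shift (p + ?l) z = shift (q + ?l) y"
      using pq(4) by (metis add.commute shift_shift)
    moreover have "m = int_diff (p + ?l) (q + ?l)" by (simp add: int_diff_add pq(3))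
    ultimately show ?case by blast
  qed simp
  with y show "y \<in> X \<and> (\<exists>p q. m = int_diff p q \<and> shift p z = shift q y \<and>
     lift_rel m (cyl_rel (z (0, p)) (y (0, q))) \<subseteq> W)" by blast
qed

lemma openin_range_image:
  assumes "openin (arrows G) W"
  shows "openin (path_space \<Lambda>) (rg G ` W)"
proof (subst openin_subopen, clarify)
  fix z m y assume W: "(z, m, y) \<in> W"
  from arrows_basis[OF assms W] obtain p q where z: "z \<in> X" "y \<in> X" "shift p z = shift q y"
    and sub: "lift_rel m (cyl_rel (z (0, p)) (y (0, q))) \<subseteq> W" by blast
  have par: "parallel (y (0, q)) (z (0, p))" using parallel_paths[OF z] by (rule parallel_sym)
  have "cylinder \<Lambda> (z (0, p)) \<subseteq> rg G ` W"
  proof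
    fix z' assume "z' \<in> cylinder \<Lambda> (z (0, p))"
    then obtain y' where "(y', z') \<in> cyl_rel (y (0, q)) (z (0, p))" using cyl_rel_total[OF par] by blast
    then have "(z', y') \<in> cyl_rel (z (0, p)) (y (0, q))" using cyl_rel_converse by blast
    then have "(z', m, y') \<in> W" using sub by auto
    then show "z' \<in> rg G ` W" by force
  qed
  moreover have "z \<in> cylinder \<Lambda> (z (0, p))" using z(1) by (simp add: cylinder_def)
  moreover have "openin (path_space \<Lambda>) (cylinder \<Lambda> (z (0, p)))"
    using z(1) by (simp add: openin_cylinder path_seg)
  ultimately show "\<exists>T. openin (path_space \<Lambda>) T \<and> rg G (z, m, y) \<in> T \<and> T \<subseteq> rg G ` W" by auto
qed

lemma openin_source_image:
  assumes "openin (arrows G) W"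
  shows "openin (path_space \<Lambda>) (sr G ` W)"
  using openin_range_image[OF openin_ginv[OF assms]] by (simp add: image_image)

text \<open>
  The range and source maps are continuous and open, so injectivity is all that is left to check.
\<close>

lemma open_bisectionI:
  assumes W: "openin (arrows G) W" and inj: "inj_on (rg G) W" "inj_on (sr G) W"
  shows "open_bisection G W"
proof -
  have "homeomorphic_map (subtopology (arrows G) W) (subtopology (path_space \<Lambda>) (f ` W)) f"
    if f: "continuous_map (arrows G) (path_space \<Lambda>) f" "inj_on f W"
      "\<And>W. openin (arrows G) W \<Longrightarrow> openin (path_space \<Lambda>) (f ` W)" for f
  proof (rule bijective_open_imp_homeomorphic_map)
    have top: "topspace (subtopology (arrows G) W) = W" using openin_subset[OF W] by auto
    show "continuous_map (subtopology (arrows G) W) (subtopology (path_space \<Lambda>) (f ` W)) f"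
      using f(1) by (simp add: continuous_map_in_subtopology continuous_map_from_subtopology top)
    show "open_map (subtopology (arrows G) W) (subtopology (path_space \<Lambda>) (f ` W)) f"
      unfolding open_map_def
    proof (intro allI impI)
      fix U assume "openin (subtopology (arrows G) W) U"
      then have "openin (arrows G) U" "U \<subseteq> W" using openin_open_subtopology[OF W] by auto
      then show "openin (subtopology (path_space \<Lambda>) (f ` W)) (f ` U)"
        using f(3) openin_open_subtopology[OF f(3)[OF W]] by auto
    qed
    show "f ` topspace (subtopology (arrows G) W) = topspace (subtopology (path_space \<Lambda>) (f ` W))"
      unfolding top topspace_subtopology_subset[OF openin_subset[OF f(3)[OF W]]] ..
    show "inj_on f (topspace (subtopology (arrows G) W))" unfolding top by (rule f(2))
  qed
  from this[OF continuous_map_rg_sr(1) inj(1) openin_range_image]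
    this[OF continuous_map_rg_sr(2) inj(2) openin_source_image]
  show ?thesis
    unfolding open_bisection_def using W openin_range_image openin_source_image by simp
qed

end


section \<open>Harmonious families from partial actions\<close>

context row_finite_graph
begin

text \<open>
  The isotropy group at \<open>x\<close>, identified with its image under the cocycle.
\<close>

definition isotropy_degrees :: "('a, 'k) path \<Rightarrow> (int ^ 'k) set" where
  "isotropy_degrees x = {int_diff p q |p q. shift p x = shift q x}"

lemma isotropy_degrees_subgroup:
  shows "0 \<in> isotropy_degrees x"
    and "m \<in> isotropy_degrees x \<Longrightarrow> - m \<in> isotropy_degrees x"
    and "m \<in> isotropy_degrees x \<Longrightarrow> n \<in> isotropy_degrees x \<Longrightarrow> m + n \<in> isotropy_degrees x"
proof -
  show "0 \<in> isotropy_degrees x"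
    unfolding isotropy_degrees_def using int_diff_zero[of 0] by force
  show "- m \<in> isotropy_degrees x" if "m \<in> isotropy_degrees x"
    using that unfolding isotropy_degrees_def by (auto simp: int_diff_swap[symmetric]) metis
  assume "m \<in> isotropy_degrees x" "n \<in> isotropy_degrees x"
  then obtain p q p' q' where "m = int_diff p q" "n = int_diff p' q'"
    "shift p x = shift q x" "shift p' x = shift q' x" unfolding isotropy_degrees_def by blast
  moreover from this have "shift (p + p') x = shift (q + q') x"
    by (metis add.commute shift_shift)
  ultimately have "m + n = int_diff (p + p') (q + q') \<and> shift (p + p') x = shift (q + q') x"
    by (simp add: int_diff_add)
  then show "m + n \<in> isotropy_degrees x" unfolding isotropy_degrees_def by blast
qed

lemma closed_ess_isotropy_at_degree:
  assumes "\<alpha> \<in> closed_ess_isotropy_at G x"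
  obtains m where "\<alpha> = (x, m, x)" "m \<in> isotropy_degrees x"
proof -
  have "\<alpha> \<in> topspace (arrows G)" "rg G \<alpha> = sr G \<alpha>" "sr G \<alpha> = x"
    using assms by (auto simp: closed_ess_isotropy_at_def isotropy_at_def isotropy_def)
  then obtain p q where "\<alpha> = (x, int_diff p q, x)" "shift p x = shift q x"
    by (auto simp: topspace_deaconu_renault)
  then show thesis using that unfolding isotropy_degrees_def by blast
qed

lemma openin_lift_cyl_union: "cyl_union m R \<Longrightarrow> openin (arrows G) (lift_rel m R)"
proof (induction R rule: cyl_union.induct)
  case empty
  have "lift_rel m {} = {}" by (auto simp: lift_rel_def)
  then show ?case by simp
next
  case (insert R \<mu> \<nu>)
  have "lift_rel m (cyl_rel \<mu> \<nu> \<union> R) = lift_rel m (cyl_rel \<mu> \<nu>) \<union> lift_rel m R"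
    by (auto simp: lift_rel_def)
  with insert openin_lift_cyl_rel show ?case by auto
qed

text \<open>
  The relations \<open>\<Phi> m\<close> form a partial action of the isotropy group that fixes \<open>x\<close>. The inclusion
  \<open>\<Phi> m O \<Phi> n \<subseteq> \<Phi> (m + n)\<close> gives multiplicativity of the bisections outright. Applied to \<open>n = - m\<close> it shows
  that each \<open>\<Phi> m\<close> is a partial bijection inside the cylinder of \<open>\<mu>\<close>, whence the bisection property;
  the sources are compact as finite unions of cylinders.
\<close>

lemma harmonious_family_from_partial_action:
  assumes \<mu>: "\<mu> \<in> mors \<Lambda>"
    and zero: "\<Phi> 0 = Id_on (cylinder \<Lambda> \<mu>)"
    and cyl: "\<And>m. m \<in> isotropy_degrees x \<Longrightarrow> cyl_union m (\<Phi> m)"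
    and fixed: "\<And>m. m \<in> isotropy_degrees x \<Longrightarrow> (x, x) \<in> \<Phi> m"
    and conv: "\<And>m. m \<in> isotropy_degrees x \<Longrightarrow> \<Phi> (- m) = (\<Phi> m)\<inverse>"
    and comp: "\<And>m n. m \<in> isotropy_degrees x \<Longrightarrow> n \<in> isotropy_degrees x \<Longrightarrow> \<Phi> m O \<Phi> n \<subseteq> \<Phi> (m + n)"
  shows "harmonious_family (path_space \<Lambda>) shift x (\<lambda>\<alpha>. lift_rel (cocycle \<alpha>) (\<Phi> (cocycle \<alpha>)))"
proof -
  let ?I = "ess_isotropy G" and ?A = "isotropy_degrees x"
  have fun_snd: "z = z' \<and> y \<in> cylinder \<Lambda> \<mu>"
    if "m \<in> ?A" "(z, y) \<in> \<Phi> m" "(z', y) \<in> \<Phi> m" for m z z' y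
  proof -
    have "(z, z') \<in> \<Phi> m O \<Phi> (- m)" "(y, y) \<in> \<Phi> (- m) O \<Phi> m" using that conv by auto
    then have "(z, z') \<in> \<Phi> 0" "(y, y) \<in> \<Phi> 0"
      using comp[OF that(1) isotropy_degrees_subgroup(2)[OF that(1)]]
        comp[OF isotropy_degrees_subgroup(2)[OF that(1)] that(1)] by auto
    then show ?thesis by (auto simp: zero)
  qed
  have fun_fst: "y = y'" if "m \<in> ?A" "(z, y) \<in> \<Phi> m" "(z, y') \<in> \<Phi> m" for m z y y'
    using fun_snd[OF isotropy_degrees_subgroup(2)[OF that(1)]] conv[OF that(1)] that by blast
  have src: "sr G ` lift_rel m (\<Phi> m) = Range (\<Phi> m)" for m
    by (force simp: lift_rel_def)
  have unit: "cylinder \<Lambda> \<mu> \<subseteq> X" by (auto simp: cylinder_def)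
  show ?thesis
    unfolding harmonious_family_def Let_def
  proof (intro conjI ballI)
    fix \<alpha> assume "\<alpha> \<in> closed_ess_isotropy_at G x"
    then obtain m where \<alpha>: "\<alpha> = (x, m, x)" and m: "m \<in> ?A" by (rule closed_ess_isotropy_at_degree)
    show "open_bisection G (lift_rel (cocycle \<alpha>) (\<Phi> (cocycle \<alpha>)))"
      unfolding \<alpha> cocycle_simp
    proof (rule open_bisectionI[OF openin_lift_cyl_union[OF cyl[OF m]]])
      show "inj_on (rg G) (lift_rel m (\<Phi> m))" "inj_on (sr G) (lift_rel m (\<Phi> m))"
        using fun_snd[OF m] fun_fst[OF m] by (auto simp: lift_rel_def intro!: inj_onI)
    qed
    show "\<alpha> \<in> lift_rel (cocycle \<alpha>) (\<Phi> (cocycle \<alpha>))" using fixed[OF m] by (simp add: \<alpha>)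
    show "cocycle \<gamma> = cocycle \<alpha>" if "\<gamma> \<in> lift_rel (cocycle \<alpha>) (\<Phi> (cocycle \<alpha>))" for \<gamma>
      using that by (auto simp: lift_rel_def)
    show "ginv G ` (lift_rel (cocycle \<alpha>) (\<Phi> (cocycle \<alpha>)) \<inter> ?I) =
        lift_rel (cocycle (ginv G \<alpha>)) (\<Phi> (cocycle (ginv G \<alpha>))) \<inter> ?I"
    proof -
      have inv: "(z, - n, y) \<in> ?I" if "(y, n, z) \<in> ?I" for y n z
        using ess_isotropy_ginv[OF that] by simp
      have "ginv G ` (lift_rel n (\<Phi> n) \<inter> ?I) \<subseteq> lift_rel (- n) (\<Phi> (- n)) \<inter> ?I" if "n \<in> ?A" for n
        using conv[OF that] inv by (auto simp: lift_rel_def)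
      note sub = this
      have "lift_rel (- m) (\<Phi> (- m)) \<inter> ?I = ginv G ` ginv G ` (lift_rel (- m) (\<Phi> (- m)) \<inter> ?I)"
        by (simp add: image_image)
      also have "\<dots> \<subseteq> ginv G ` (lift_rel m (\<Phi> m) \<inter> ?I)"
        using image_mono[OF sub[OF isotropy_degrees_subgroup(2)[OF m]]] by simp
      finally show ?thesis using sub[OF m] by (simp add: \<alpha> subset_antisym)
    qed
    show "\<exists>K. compactin (path_space \<Lambda>) K \<and> sr G ` lift_rel (cocycle \<alpha>) (\<Phi> (cocycle \<alpha>)) =
        K \<inter> sr G ` lift_rel (cocycle (unt G x)) (\<Phi> (cocycle (unt G x)))"
    proof (intro exI conjI)
      show "compactin (path_space \<Lambda>) (Range (\<Phi> m))" by (rule compactin_cyl_union_Range[OF cyl[OF m]])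
      have "Range (\<Phi> m) \<subseteq> cylinder \<Lambda> \<mu>" using fun_snd[OF m] by blast
      then show "sr G ` lift_rel (cocycle \<alpha>) (\<Phi> (cocycle \<alpha>)) =
        Range (\<Phi> m) \<inter> sr G ` lift_rel (cocycle (unt G x)) (\<Phi> (cocycle (unt G x)))"
        by (simp add: \<alpha> src src[of 0, unfolded zero] zero Int_absorb2 del: Range_iff)
    qed
    fix \<beta> assume "\<beta> \<in> closed_ess_isotropy_at G x"
    then obtain n where \<beta>: "\<beta> = (x, n, x)" and n: "n \<in> ?A" by (rule closed_ess_isotropy_at_degree)
    show "set_mul G (lift_rel (cocycle \<alpha>) (\<Phi> (cocycle \<alpha>))) (lift_rel (cocycle \<beta>) (\<Phi> (cocycle \<beta>)) \<inter> ?I)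
        \<subseteq> lift_rel (cocycle (mul G \<alpha> \<beta>)) (\<Phi> (cocycle (mul G \<alpha> \<beta>)))"
      using comp[OF m n] by (auto simp: \<alpha> \<beta> set_mul_def lift_rel_def)
  next
    show "lift_rel (cocycle (unt G x)) (\<Phi> (cocycle (unt G x))) \<subseteq> unt G ` topspace (path_space \<Lambda>)"
      using unit by (auto simp: zero lift_rel_def topspace_path_space)
  qed
qed

end


section \<open>The cyclic case: iterating one partial homeomorphism\<close>

text \<open>
  Integer powers of a partial bijection of \<open>V\<close>; the power \<open>0\<close> is the identity of all of \<open>V\<close>, so that
  it contains the identities of the domains of all other powers.
\<close>

definition rel_ipow :: "'b set \<Rightarrow> 'b rel \<Rightarrow> int \<Rightarrow> 'b rel" where
  "rel_ipow V R k = (if k = 0 then Id_on V else if k > 0 then R ^^ nat k else (R\<inverse>) ^^ nat (- k))"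

lemma rel_ipow_zero [simp]: "rel_ipow V R 0 = Id_on V"
  by (simp add: rel_ipow_def)

lemma rel_ipow_of_converse: "rel_ipow V (R\<inverse>) k = rel_ipow V R (- k)"
  by (simp add: rel_ipow_def)

lemma rel_ipow_Suc:
  "rel_ipow V R (int (Suc n)) = R ^^ Suc n" "rel_ipow V R (- int (Suc n)) = (R\<inverse>) ^^ Suc n"
  by (simp_all add: rel_ipow_def del: relpow.simps of_nat_Suc)

lemma relpow_Suc_left: "(R :: 'b rel) O R ^^ n = R ^^ Suc n"
  by (simp add: relpow_commute)

lemma relpow_converse: "((R :: 'b rel) ^^ n)\<inverse> = (R\<inverse>) ^^ n"
  by (induction n) (simp_all add: converse_relcomp relpow_commute)

lemma rel_ipow_minus: "rel_ipow V R (- k) = (rel_ipow V R k)\<inverse>"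
  by (simp add: rel_ipow_def relpow_converse)

lemma rel_ipow_step:
  assumes "R \<subseteq> V \<times> V" "single_valued R" "single_valued (R\<inverse>)"
  shows "R O rel_ipow V R k \<subseteq> rel_ipow V R (k + 1)"
proof -
  consider "k = 0" | n where "k = int (Suc n)" | "k = -1" | n where "k = - int (Suc (Suc n))"
    by (metis add.inverse_inverse int_cases2 not0_implies_Suc of_nat_0 of_nat_1 One_nat_def add.inverse_neutral)
  then show ?thesis
  proof cases
    case 2
    then have "nat k = Suc n" "nat (k + 1) = Suc (Suc n)" "k > 0" by simp_all
    then show ?thesis using relpow_Suc_left[of R "Suc n"] by (simp add: rel_ipow_def del: relpow.simps)
  next
    case 4
    have "R O (R\<inverse>) ^^ Suc (Suc n) = R O (R\<inverse> O (R\<inverse>) ^^ Suc n)"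
      by (simp only: relpow_Suc_left)
    also have "\<dots> = (R O R\<inverse>) O (R\<inverse>) ^^ Suc n" by (simp only: O_assoc)
    also have "\<dots> \<subseteq> Id O (R\<inverse>) ^^ Suc n"
      by (rule relcomp_mono) (use assms(3) in \<open>auto simp: single_valued_def\<close>)
    finally have "R O (R\<inverse>) ^^ Suc (Suc n) \<subseteq> (R\<inverse>) ^^ Suc n" by simp
    moreover have "nat (- k) = Suc (Suc n)" "nat (- (k + 1)) = Suc n" "k < 0" "k + 1 < 0"
      using 4 by simp_all
    ultimately show ?thesis by (simp add: rel_ipow_def del: relpow.simps)
  next
    case 3
    have "R O R\<inverse> \<subseteq> Id_on V" using assms(1,3) unfolding single_valued_def by fastforce
    with 3 show ?thesis by (simp add: rel_ipow_def)
  qed (auto simp: rel_ipow_def)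
qed

text \<open>
  For a partial bijection, cancelling \<open>R\<close> against its converse only loses points of the
  domain, so the integer powers form a partial action of the integers.
\<close>

lemma rel_ipow_add:
  assumes "R \<subseteq> V \<times> V" "single_valued R" "single_valued (R\<inverse>)"
  shows "rel_ipow V R j O rel_ipow V R k \<subseteq> rel_ipow V R (j + k)"
proof -
  have pos: "R ^^ Suc n O rel_ipow V R k \<subseteq> rel_ipow V R (int (Suc n) + k)"
    if "R \<subseteq> V \<times> V" "single_valued R" "single_valued (R\<inverse>)" for R :: "'a rel" and n k
  proof (induction n arbitrary: k)
    case 0
    then show ?case using rel_ipow_step[OF that, of k] by (simp add: add.commute)
  next
    case (Suc n)
    have "R ^^ Suc (Suc n) O rel_ipow V R k = R ^^ Suc n O (R O rel_ipow V R k)"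
      by (simp add: O_assoc)
    also have "\<dots> \<subseteq> R ^^ Suc n O rel_ipow V R (k + 1)"
      by (rule relcomp_mono[OF order_refl rel_ipow_step[OF that]])
    also have "\<dots> \<subseteq> rel_ipow V R (int (Suc n) + (k + 1))" by (rule Suc.IH)
    finally show ?case by (simp add: ac_simps)
  qed
  consider "j = 0" | n where "j = int (Suc n)" | n where "j = - int (Suc n)"
    by (metis int_cases2 not0_implies_Suc of_nat_0 add.inverse_neutral)
  then show ?thesis
  proof cases
    case 1
    then show ?thesis by auto
  next
    case 2
    show ?thesis unfolding 2 rel_ipow_Suc(1) by (rule pos[OF assms])
  next
    case 3
    have "R\<inverse> \<subseteq> V \<times> V" using assms(1) by auto
    from pos[OF this assms(3), of n "- k"] assms(2)
    have "(R\<inverse>) ^^ Suc n O rel_ipow V R k \<subseteq> rel_ipow V R (- (int (Suc n) + - k))"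
      unfolding rel_ipow_of_converse by simp
    moreover have "- (int (Suc n) + - k) = j + k" using 3 by simp
    moreover have "rel_ipow V R j = (R\<inverse>) ^^ Suc n" unfolding 3 by (rule rel_ipow_Suc(2))
    ultimately show ?thesis by (simp only:)
  qed
qed

context row_finite_graph
begin

lemma cyl_union_rel_ipow:
  assumes "cyl_union a R" "\<mu> \<in> mors \<Lambda>"
  shows "cyl_union (k *s a) (rel_ipow (cylinder \<Lambda> \<mu>) R k)"
proof -
  have pos: "cyl_union (int (Suc n) *s a) (R ^^ Suc n)" if "cyl_union a R" for a R n
  proof (induction n)
    case (Suc n)
    have "int (Suc (Suc n)) *s a = int (Suc n) *s a + a" by (simp add: vec_eq_iff algebra_simps)
    then show ?case using cyl_union_comp[OF Suc that] by simp
  qed (use that in \<open>simp add: vec_eq_iff\<close>)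
  consider "k = 0" | n where "k = int (Suc n)" | n where "k = - int (Suc n)"
    by (metis int_cases2 not0_implies_Suc of_nat_0 add.inverse_neutral)
  then show ?thesis
  proof cases
    case 1
    have "parallel \<mu> \<mu>" using assms(2) by (simp add: parallel_def)
    from cyl_union_basic[OF this, of 0] 1 show ?thesis by (simp add: cyl_rel_Id)
  next
    case 2
    show ?thesis unfolding 2 rel_ipow_Suc(1) by (rule pos[OF assms(1)])
  next
    case 3
    have "k *s a = int (Suc n) *s (- a)" using 3 by (simp add: vec_eq_iff)
    moreover have "rel_ipow (cylinder \<Lambda> \<mu>) R k = (R\<inverse>) ^^ Suc n" unfolding 3 by (rule rel_ipow_Suc(2))
    ultimately show ?thesis using pos[OF cyl_union_converse[OF assms(1)], of n] by simp
  qed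
qed

lemma cyl_rel_partial_bij:
  "single_valued (cyl_rel \<mu> \<nu>)" "single_valued ((cyl_rel \<mu> \<nu>)\<inverse>)"
proof -
  have sv: "single_valued ((cyl_rel \<mu> \<nu>)\<inverse>)" for \<mu> \<nu>
    using cyl_rel_single_valued[of _ _ \<mu> \<nu>] by (auto simp: single_valued_def)
  show "single_valued ((cyl_rel \<mu> \<nu>)\<inverse>)" by (rule sv)
  show "single_valued (cyl_rel \<mu> \<nu>)" using sv[of \<nu> \<mu>] by (simp add: cyl_rel_converse)
qed

text \<open>
  If \<open>a = p - q\<close> generates the isotropy group, where the shifts of \<open>x\<close> by \<open>p\<close> and \<open>q\<close> agree, replacing
  the initial segment \<open>x(0, q)\<close> by \<open>x(0, p)\<close> is a partial homeomorphism fixing \<open>x\<close>, and its powers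
  form the required partial action. The function \<open>\<kappa>\<close> reads off the exponent; when \<open>a = 0\<close> the
  equation \<open>m = \<kappa> m *s a\<close> does not determine the exponent, hence the separate additivity assumption.
\<close>

lemma harmonious_family_cyclic:
  fixes \<kappa> :: "int ^ 'k \<Rightarrow> int"
  assumes x: "x \<in> X" and a: "a \<in> isotropy_degrees x"
    and gen: "\<And>m. m \<in> isotropy_degrees x \<Longrightarrow> m = \<kappa> m *s a"
    and add: "\<And>m n. m \<in> isotropy_degrees x \<Longrightarrow> n \<in> isotropy_degrees x \<Longrightarrow> \<kappa> (m + n) = \<kappa> m + \<kappa> n"
  shows "\<exists>B. harmonious_family (path_space \<Lambda>) shift x B"
proof -
  let ?A = "isotropy_degrees x" and ?\<mu> = "x (0, 0)"
  let ?V = "cylinder \<Lambda> ?\<mu>"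
  obtain p q where pq: "a = int_diff p q" "shift p x = shift q x"
    using a by (auto simp: isotropy_degrees_def)
  define R where "R = cyl_rel (x (0, p)) (x (0, q))"
  have \<mu>: "?\<mu> \<in> mors \<Lambda>" using x by (simp add: path_seg)
  have "cylinder \<Lambda> (x (0, n)) \<subseteq> ?V" for n by (intro cylinder_antimono path_prefix x) simp
  then have R: "R \<subseteq> ?V \<times> ?V" unfolding R_def cyl_rel_def by blast
  have sv: "single_valued R" "single_valued (R\<inverse>)" by (simp_all only: R_def cyl_rel_partial_bij)
  have cu: "cyl_union a R"
    unfolding R_def using x pq by (intro cyl_union_basic parallel_paths) simp_all
  have xV: "x \<in> ?V" using x by (simp add: cylinder_def)
  have xR: "(x, x) \<in> R" using x pq(2) by (simp add: R_def cyl_rel_def cylinder_def)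
  have "(x, x) \<in> Q ^^ n" if "(x, x) \<in> Q" for Q and n :: nat
    by (induction n) (use that in auto)
  then have fixed: "(x, x) \<in> rel_ipow ?V R k" for k
    using xR xV by (simp add: rel_ipow_def Id_on_iff)
  have \<kappa>0: "\<kappa> 0 = 0" using add[of 0 0] isotropy_degrees_subgroup(1) by simp
  have \<kappa>_minus: "\<kappa> (- m) = - \<kappa> m" if "m \<in> ?A" for m
    using add[OF that isotropy_degrees_subgroup(2)[OF that]] \<kappa>0 by simp
  define \<Phi> where "\<Phi> m = rel_ipow ?V R (\<kappa> m)" for m
  have "harmonious_family (path_space \<Lambda>) shift x (\<lambda>\<alpha>. lift_rel (cocycle \<alpha>) (\<Phi> (cocycle \<alpha>)))"
  proof (rule harmonious_family_from_partial_action[OF \<mu>])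
    fix m assume m: "m \<in> ?A"
    show "cyl_union m (\<Phi> m)"
      using cyl_union_rel_ipow[OF cu \<mu>, of "\<kappa> m"] gen[OF m] by (simp add: \<Phi>_def)
    show "\<Phi> (- m) = (\<Phi> m)\<inverse>" by (simp add: \<Phi>_def \<kappa>_minus[OF m] rel_ipow_minus)
    fix n assume "n \<in> ?A"
    with rel_ipow_add[OF R sv] add[OF m] show "\<Phi> m O \<Phi> n \<subseteq> \<Phi> (m + n)" by (simp add: \<Phi>_def)
  qed (simp_all add: \<Phi>_def \<kappa>0 fixed)
  then show ?thesis by blast
qed


section \<open>The case of eventual periodicity in all directions\<close>

text \<open>
  As \<open>(K, ..., K)\<close> is in the isotropy group, the path \<open>y = shift n x\<close> satisfies \<open>y = shift (K, ..., K) y\<close>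
  for some \<open>n\<close>. Let \<open>M\<close> be the monoid of all \<open>p\<close> with \<open>shift p y = y\<close>. Each \<open>p \<in> M\<close> gives a loop
  \<open>y(0, p)\<close> at the vertex \<open>y(0)\<close>, and prepending these loops to the paths starting at that vertex
  defines commuting injective maps, that is, an action of \<open>M\<close>. Such an action extends to an action
  of the group of differences of \<open>M\<close> on a larger space, and restricting this group
  action to the original space gives a partial action: the difference \<open>p - q\<close> takes \<open>b\<close> to \<open>a\<close> if
  prepending \<open>y(0, q)\<close> to \<open>a\<close> and \<open>y(0, p)\<close> to \<open>b\<close> gives the same path. The larger space stays in
  the background; only the relations between \<open>a\<close> and \<open>b\<close> are used. It matters that their
  domains are taken as large as possible: if \<open>p - q\<close> fixes \<open>b\<close>, then multiplicativity forces all its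
  multiples to fix \<open>b\<close>, whereas prescribing for each difference initial segments of \<open>a\<close> and \<open>b\<close>
  that grow with \<open>p\<close> and \<open>q\<close> would remove \<open>b\<close> from the domains of high multiples.
\<close>

lemma harmonious_family_periodic:
  assumes x: "x \<in> X" and K: "K > 0" and c: "(\<chi> i. int K) \<in> isotropy_degrees x"
  shows "\<exists>B. harmonious_family (path_space \<Lambda>) shift x B"
proof -
  let ?A = "isotropy_degrees x"
  obtain p0 n where n: "(\<chi> i. int K) = int_diff p0 n" "shift p0 x = shift n x"
    using c by (auto simp: isotropy_degrees_def)
  let ?l = "x (0, n)"
  let ?V = "cylinder \<Lambda> ?l"
  define M where "M = {p. shift (n + p) x = shift n x}"
  \<comment> \<open>\<open>\<epsilon> p\<close> inserts the loop \<open>x(n, n + p)\<close> right after the initial segment \<open>x(0, n)\<close>.\<close>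
  define \<epsilon> where "\<epsilon> p = cyl_rel (x (0, n + p)) ?l" for p
  have M0: "0 \<in> M" by (simp add: M_def)
  have M_add: "p + q \<in> M" if "p \<in> M" "q \<in> M" for p q
  proof -
    have "shift (n + (p + q)) x = shift q (shift (n + p) x)" by (simp add: shift_shift ac_simps)
    also have "\<dots> = shift (n + q) x" using that(1) by (simp add: M_def shift_shift ac_simps)
    finally show ?thesis using that(2) by (simp add: M_def)
  qed
  have "(\<chi> i. K) \<in> M"
  proof -
    have "p0 = n + (\<chi> i. K)"
      using n(1) by (auto simp: int_diff_def vec_eq_iff algebra_simps) (metis add.commute nat_int_comparison(1) of_nat_add)
    with n(2) show ?thesis by (simp add: M_def)
  qed
  moreover have "(\<chi> i. Suc N * K) = (\<chi> i. K) + ((\<chi> i. N * K) :: nat ^ 'k)" for N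
    by (simp add: vec_eq_iff)
  ultimately have M_const: "(\<chi> i. N * K) \<in> M" for N
    using M0 M_add by (induction N) (simp_all add: zero_vec_def[symmetric])

  \<comment> \<open>Raising \<open>p\<close> and \<open>q\<close> by the same \<open>r\<close> turns \<open>q\<close> into a multiple of the period \<open>(K, ..., K)\<close>.\<close>
  have M_diff: "\<exists>p q. p \<in> M \<and> q \<in> M \<and> m = int_diff p q" if m: "m \<in> ?A" for m
  proof -
    obtain p q where pq: "m = int_diff p q" "shift p x = shift q x"
      using m by (auto simp: isotropy_degrees_def)
    define N where "N = (\<Sum>i\<in>UNIV. q $ i)"
    have "q $ i \<le> N" for i unfolding N_def by (rule member_le_sum) auto
    also have "N \<le> N * K" using K by simp
    finally have "q \<le> (\<chi> i. N * K)" by (simp add: less_eq_vec_def)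
    then obtain r where r: "(\<chi> i. N * K) = q + r" by (rule vec_le_obtain)
    have "shift (n + (p + r)) x = shift (n + r) (shift p x)" by (simp add: shift_shift ac_simps)
    also have "\<dots> = shift (n + (q + r)) x" unfolding pq(2) by (simp add: shift_shift ac_simps)
    also have "\<dots> = shift n x" using M_const[of N] by (simp add: M_def r)
    finally have "p + r \<in> M" by (simp add: M_def)
    moreover have "q + r \<in> M" using M_const[of N] by (simp add: r)
    ultimately show ?thesis using pq(1) int_diff_add[of p r q r] by fastforce
  qed

  have par: "parallel (x (0, n + p)) ?l" if "p \<in> M" for p
    using that by (intro parallel_paths x) (simp add: M_def)
  have \<epsilon>_V: "\<epsilon> p \<subseteq> ?V \<times> ?V" for p
    using cylinder_antimono[OF path_prefix[OF x, of n "n + p"]] by (auto simp: \<epsilon>_def cyl_rel_def)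
  have \<epsilon>_total: "\<exists>z. (z, y) \<in> \<epsilon> p" if "p \<in> M" "y \<in> ?V" for p y
    using cyl_rel_total[OF par] that by (simp add: \<epsilon>_def)
  have \<epsilon>_fun: "z = z'" if "(z, y) \<in> \<epsilon> p" "(z', y) \<in> \<epsilon> p" for z z' y p
    using that cyl_rel_single_valued by (simp add: \<epsilon>_def)
  have \<epsilon>_inj: "y = y'" if "(z, y) \<in> \<epsilon> p" "(z, y') \<in> \<epsilon> p" for z y y' p
    using that cyl_rel_partial_bij(1) by (auto simp: \<epsilon>_def single_valued_def)
  have \<epsilon>_comp: "\<epsilon> p O \<epsilon> q \<subseteq> \<epsilon> (p + q)" if "p \<in> M" "q \<in> M" for p q
  proof clarify
    fix z u t assume "(z, u) \<in> \<epsilon> p" "(u, t) \<in> \<epsilon> q"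
    then have z: "z \<in> X" "z (0, n + p) = x (0, n + p)" "shift (n + p) z = shift n u"
      and u: "u \<in> X" "u (0, n + q) = x (0, n + q)" "shift (n + q) u = shift n t"
      and t: "t \<in> X" "t (0, n) = x (0, n)"
      using x by (auto simp: \<epsilon>_def cyl_rel_def cylinder_def)
    have "shift (n + p) z (0, q) = shift (n + p) x (0, q)"
      using z(3) path_split_iff[OF u(1) x, of n q] u(2) that(1) by (simp add: M_def)
    then have "z (0, n + (p + q)) = x (0, n + (p + q))"
      using path_split_iff[OF z(1) x, of "n + p" q] z(2) by (simp add: add.assoc)
    moreover have "shift (n + (p + q)) z = shift q (shift (n + p) z)" by (simp add: shift_shift ac_simps)
    then have "shift (n + (p + q)) z = shift n t" unfolding z(3) using u(3) by (simp add: shift_shift ac_simps)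
    ultimately show "(z, t) \<in> \<epsilon> (p + q)" using z(1) t x by (simp add: \<epsilon>_def cyl_rel_def cylinder_def)
  qed
  have \<epsilon>_add: "\<epsilon> (p + q) = \<epsilon> p O \<epsilon> q" if M: "p \<in> M" "q \<in> M" for p q
  proof
    show "\<epsilon> (p + q) \<subseteq> \<epsilon> p O \<epsilon> q"
    proof clarify
      fix z t assume zt: "(z, t) \<in> \<epsilon> (p + q)"
      then obtain u where u: "(u, t) \<in> \<epsilon> q" using \<epsilon>_total[OF M(2)] \<epsilon>_V by blast
      then obtain z' where z': "(z', u) \<in> \<epsilon> p" using \<epsilon>_total[OF M(1)] \<epsilon>_V by blast
      with u \<epsilon>_comp[OF M] have "(z', t) \<in> \<epsilon> (p + q)" by blast
      with \<epsilon>_fun zt have "z' = z" by blast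
      with u z' show "(z, t) \<in> \<epsilon> p O \<epsilon> q" by blast
    qed
  qed (rule \<epsilon>_comp[OF M])
  have \<epsilon>_cancel: "(\<epsilon> r)\<inverse> O \<epsilon> r = Id_on ?V" if "r \<in> M" for r
    using \<epsilon>_total[OF that] \<epsilon>_V[of r] \<epsilon>_inj by (auto simp: Id_on_iff) blast+

  define \<Psi> where "\<Psi> p q = (\<epsilon> q)\<inverse> O \<epsilon> p" for p q
  \<comment> \<open>The fraction \<open>p - q\<close> may be expanded by any \<open>r \<in> M\<close>, since \<open>\<epsilon> r\<close> is total and injective.\<close>
  have \<Psi>_add: "\<Psi> (p + r) (q + r) = \<Psi> p q" if "p \<in> M" "q \<in> M" "r \<in> M" for p q r
  proof -
    have "\<Psi> (p + r) (q + r) = (\<epsilon> q)\<inverse> O ((\<epsilon> r)\<inverse> O \<epsilon> r) O \<epsilon> p"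
      using \<epsilon>_add[OF that(3,1)] \<epsilon>_add[OF that(3,2)]
      by (simp add: \<Psi>_def add.commute[of _ r] converse_relcomp O_assoc)
    also have "\<dots> = \<Psi> p q" unfolding \<epsilon>_cancel[OF that(3)] \<Psi>_def using \<epsilon>_V[of p] by auto
    finally show ?thesis .
  qed
  have \<Psi>_eq: "\<Psi> p q = \<Psi> p' q'" if "p \<in> M" "q \<in> M" "p' \<in> M" "q' \<in> M" "int_diff p q = int_diff p' q'"
    for p q p' q'
  proof -
    have "p + q' = p' + q" using that(5) by (simp add: int_diff_eq_iff)
    then show ?thesis
      using \<Psi>_add[OF that(1,2,4)] \<Psi>_add[OF that(3,4,2)] by (simp add: add.commute)
  qed
  have \<Psi>_comp: "\<Psi> p q O \<Psi> p' q' \<subseteq> \<Psi> (p + p') (q + q')"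
    if M: "p \<in> M" "q \<in> M" "p' \<in> M" "q' \<in> M" for p q p' q'
  proof
    fix ac assume "ac \<in> \<Psi> p q O \<Psi> p' q'"
    then obtain a' b c' u v where ac: "ac = (a', c')"
      and u: "(u, a') \<in> \<epsilon> q" "(u, b) \<in> \<epsilon> p" and v: "(v, b) \<in> \<epsilon> q'" "(v, c') \<in> \<epsilon> p'"
      by (auto simp: \<Psi>_def)
    have "u \<in> ?V" using u \<epsilon>_V by blast
    then obtain s where s: "(s, u) \<in> \<epsilon> q'" using \<epsilon>_total M by blast
    \<comment> \<open>\<open>u\<close> and \<open>v\<close> have the common image \<open>s\<close>, as \<open>\<epsilon> p\<close> and \<open>\<epsilon> q'\<close> commute and take \<open>b\<close> to \<open>u\<close> and \<open>v\<close>.\<close>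
    have "(s, b) \<in> \<epsilon> q' O \<epsilon> p" using s u by blast
    then have "(s, b) \<in> \<epsilon> p O \<epsilon> q'" using \<epsilon>_add M by (metis add.commute)
    then have "(s, v) \<in> \<epsilon> p" using v(1) \<epsilon>_fun by blast
    then have "(s, c') \<in> \<epsilon> (p + p')" using v(2) \<epsilon>_comp M by blast
    moreover have "(s, a') \<in> \<epsilon> (q + q')" using s u(1) \<epsilon>_comp[OF M(4,2)] by (auto simp: add.commute)
    ultimately show "ac \<in> \<Psi> (p + p') (q + q')" by (auto simp: \<Psi>_def ac)
  qed

  define \<Phi> where "\<Phi> m = (\<Union>(p, q)\<in>{(p, q). p \<in> M \<and> q \<in> M \<and> m = int_diff p q}. \<Psi> p q)" for m
  have \<Phi>_eq: "\<Phi> (int_diff p q) = \<Psi> p q" if "p \<in> M" "q \<in> M" for p q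
    using that \<Psi>_eq unfolding \<Phi>_def by blast
  have "harmonious_family (path_space \<Lambda>) shift x (\<lambda>\<alpha>. lift_rel (cocycle \<alpha>) (\<Phi> (cocycle \<alpha>)))"
  proof (rule harmonious_family_from_partial_action)
    show "?l \<in> mors \<Lambda>" using x by (simp add: path_seg)
    show "\<Phi> 0 = Id_on ?V"
      using \<Phi>_eq[OF M0 M0] \<epsilon>_cancel[OF M0] by (simp add: \<Psi>_def)
    fix m assume "m \<in> ?A"
    then obtain p q where pq: "p \<in> M" "q \<in> M" "m = int_diff p q" using M_diff by blast
    have \<Phi>: "\<Phi> m = \<Psi> p q" using \<Phi>_eq pq by simp
    have "cyl_union (int_diff (n + p) n) (\<epsilon> p)" if "p \<in> M" for p
      unfolding \<epsilon>_def using par[OF that] x by (intro cyl_union_basic) simp_all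
    from cyl_union_comp[OF cyl_union_converse[OF this[OF pq(2)]] this[OF pq(1)]]
    have "cyl_union (- int_diff (n + q) n + int_diff (n + p) n) (\<Psi> p q)" unfolding \<Psi>_def .
    moreover have "- int_diff (n + q) n + int_diff (n + p) n = m"
      unfolding pq(3) by (simp add: int_diff_def vec_eq_iff)
    ultimately show "cyl_union m (\<Phi> m)" by (simp add: \<Phi>)
    have "(x, x) \<in> \<epsilon> r" if "r \<in> M" for r
      using that x by (simp add: M_def \<epsilon>_def cyl_rel_def cylinder_def)
    then show "(x, x) \<in> \<Phi> m" using pq(1,2) unfolding \<Phi> \<Psi>_def by blast
    have "\<Phi> (- m) = \<Psi> q p" using \<Phi>_eq[OF pq(2,1)] int_diff_swap[of q p] pq(3) by simp
    then show "\<Phi> (- m) = (\<Phi> m)\<inverse>" by (simp add: \<Phi> \<Psi>_def converse_relcomp)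
    fix m' assume "m' \<in> ?A"
    then obtain p' q' where pq': "p' \<in> M" "q' \<in> M" "m' = int_diff p' q'" using M_diff by blast
    have "\<Phi> m' = \<Psi> p' q'" "\<Phi> (m + m') = \<Psi> (p + p') (q + q')"
      using \<Phi>_eq[OF pq'(1,2)] \<Phi>_eq[OF M_add[OF pq(1) pq'(1)] M_add[OF pq(2) pq'(2)]] pq(3) pq'(3)
      by (simp_all add: int_diff_add)
    then show "\<Phi> m O \<Phi> m' \<subseteq> \<Phi> (m + m')" using \<Psi>_comp[OF pq(1,2) pq'(1,2)] by (simp add: \<Phi>)
  qed
  then show ?thesis by blast
qed

end


section \<open>Subgroups of the integer plane\<close>

text \<open>
  Two elements with nonzero determinant span a sublattice of finite index, which contains a
  positive multiple of \<open>(1, 1)\<close> by Cramer's rule. Otherwise the subgroup lies on a line, projects injectively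
  to some coordinate axis, and is cyclic because its image there is.
\<close>

lemma int_plane_subgroup_cases:
  fixes A :: "(int ^ 2) set"
  assumes zero: "0 \<in> A" and minus: "\<And>m. m \<in> A \<Longrightarrow> - m \<in> A"
    and add: "\<And>m n. m \<in> A \<Longrightarrow> n \<in> A \<Longrightarrow> m + n \<in> A"
  obtains (positive) K :: nat where "K > 0" "(\<chi> i. int K) \<in> A"
  | (cyclic) a \<kappa> where "a \<in> A" "\<And>m. m \<in> A \<Longrightarrow> m = \<kappa> m *s a"
      "\<And>m n. m \<in> A \<Longrightarrow> n \<in> A \<Longrightarrow> \<kappa> (m + n) = \<kappa> m + \<kappa> n"
proof -
  have "int n *s m \<in> A" if "m \<in> A" for n m
  proof (induction n)
    case (Suc n)
    have "int (Suc n) *s m = m + int n *s m" by (simp add: vec_eq_iff algebra_simps)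
    with Suc add that show ?case by simp
  qed (simp add: zero zero_vec_def[symmetric] vec_eq_iff)
  note nat_scale = this
  have scale: "k *s m \<in> A" if "m \<in> A" for k m
  proof (cases k rule: int_cases2)
    case (nonpos n)
    then have "k *s m = int n *s (- m)" by (simp add: vec_eq_iff)
    then show ?thesis using nat_scale[OF minus[OF that]] by simp
  qed (use nat_scale[OF that] in simp)
  show thesis
  proof (cases "\<exists>a\<in>A. \<exists>b\<in>A. a $ 1 * b $ 2 - a $ 2 * b $ 1 \<noteq> 0")
    case True
    then obtain a b where ab: "a \<in> A" "b \<in> A" "a $ 1 * b $ 2 - a $ 2 * b $ 1 \<noteq> 0" by blast
    let ?D = "a $ 1 * b $ 2 - a $ 2 * b $ 1"
    \<comment> \<open>Cramer's rule for \<open>s *s a + t *s b = (D, D)\<close>.\<close>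
    let ?c = "(b $ 2 - b $ 1) *s a + (a $ 1 - a $ 2) *s b"
    have c: "?c = (\<chi> i. ?D)" by (simp add: vec_eq_iff forall_2 algebra_simps)
    have "?c \<in> A" using scale ab add by blast
    then have "sgn ?D *s ?c \<in> A" by (rule scale)
    moreover have "sgn ?D *s ?c = (\<chi> i. int (nat \<bar>?D\<bar>))"
    proof -
      have "sgn d * d = int (nat \<bar>d\<bar>)" for d :: int by (simp add: sgn_if)
      then show ?thesis unfolding c vec_eq_iff by (simp only: vector_smult_component vec_lambda_beta) simp
    qed
    ultimately show thesis using positive[of "nat \<bar>?D\<bar>"] ab(3) by simp
  next
    case det: False
    show thesis
    proof (cases "A = {0}")
      case True
      then show thesis using cyclic[of 0 "\<lambda>_. 0"] by simp
    next
      case False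
      then obtain a0 where "a0 \<in> A" "a0 \<noteq> 0" using zero by blast
      then obtain i where a0: "a0 \<in> A" "a0 $ i \<noteq> 0" by (auto simp: vec_eq_iff)
      define P where "P g \<longleftrightarrow> g > 0 \<and> (\<exists>a\<in>A. a $ i = int g)" for g
      have "\<exists>a\<in>A. a $ i = int (nat \<bar>a0 $ i\<bar>)"
      proof (cases "a0 $ i > 0")
        case True
        then show ?thesis using a0(1) by (intro bexI[of _ a0]) simp_all
      next
        case False
        then show ?thesis using minus[OF a0(1)] by (intro bexI[of _ "- a0"]) simp_all
      qed
      then have "P (nat \<bar>a0 $ i\<bar>)" using a0(2) by (simp add: P_def)
      then have "\<exists>g. P g" ..
      then have "P (LEAST g. P g)" by (rule LeastI_ex)
      then obtain g a where g: "g = (LEAST g. P g)" "g > 0" "a \<in> A" "a $ i = int g" by (auto simp: P_def)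
      have gen: "m = (m $ i div int g) *s a" if "m \<in> A" for m
      proof -
        define c where "c = m $ i div int g"
        define r where "r = m + (- c) *s a"
        have r: "r \<in> A" unfolding r_def using that g(3) add scale by blast
        have rj: "r $ j = m $ j - c * a $ j" for j by (simp add: r_def)
        have ri: "r $ i = m $ i mod int g"
          unfolding rj g(4) c_def by (rule minus_div_mult_eq_mod)
        have nonneg: "0 \<le> r $ i" using ri g(2) by simp
        have ri0: "r $ i = 0"
        proof (rule ccontr)
          assume "r $ i \<noteq> 0"
          then have "nat (r $ i) > 0" "r $ i = int (nat (r $ i))" using nonneg by simp_all
          then have "P (nat (r $ i))" unfolding P_def using r by blast
          then have "g \<le> nat (r $ i)" unfolding g(1) by (rule Least_le)
          then show False using ri g(2) pos_mod_bound[of "int g" "m $ i"] by linarith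
        qed
        have "r $ 1 * a $ 2 - r $ 2 * a $ 1 = 0" using det r g(3) by blast
        with ri0 g(2,4) have "r $ 1 = 0 \<and> r $ 2 = 0" using exhaust_2[of i] by auto
        then have "m $ j = c * a $ j" for j using rj[of j] exhaust_2[of j] by auto
        then show ?thesis unfolding c_def[symmetric] vec_eq_iff by simp
      qed
      show thesis
      proof (rule cyclic[OF g(3) gen])
        fix m n assume "m \<in> A" "n \<in> A"
        then have "m $ i = (m $ i div int g) * int g" "n $ i = (n $ i div int g) * int g"
          using gen g(4) by (metis vector_smult_component)+
        then show "(m + n) $ i div int g = m $ i div int g + n $ i div int g"
          using g(2) by (metis div_plus_div_distrib_dvd_left dvd_triv_right vector_add_component)
      qed
    qed
  qed
qed

theorem mainTheorem9:
  fixes \<Lambda> :: "('o, 'a, 2) graded_cat"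
  assumes "k_graph \<Lambda>"
    and "row_finite_no_sources \<Lambda>"
  shows "admits_harmonious_families (path_space \<Lambda>) shift"
proof -
  interpret row_finite_graph \<Lambda>
    using assms by unfold_locales
  have "\<exists>B. harmonious_family (path_space \<Lambda>) shift x B" if x: "x \<in> X" for x
  proof (rule int_plane_subgroup_cases[OF isotropy_degrees_subgroup])
    show ?thesis if "K > 0" "(\<chi> i. int K) \<in> isotropy_degrees x" for K
      using harmonious_family_periodic[OF x that] .
    show ?thesis if "a \<in> isotropy_degrees x" "\<And>m. m \<in> isotropy_degrees x \<Longrightarrow> m = \<kappa> m *s a"
      "\<And>m n. m \<in> isotropy_degrees x \<Longrightarrow> n \<in> isotropy_degrees x \<Longrightarrow> \<kappa> (m + n) = \<kappa> m + \<kappa> n"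
      for a \<kappa>
      using harmonious_family_cyclic[OF x that] .
  qed
  then show ?thesis by (simp add: admits_harmonious_families_def topspace_path_space)
qed

end
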